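(* Let $k\ge 2$, let $q_1,\ldots,q_k$ be nonnegative integers, let $b=2k-1$, let $C=C(q_1,\ldots,q_k)$ (a $b\times b$ matrix) and, for $1\le i\le k-1$, let $\widetilde C_{(i)}$ be the $(b-1)\times(b-1)$ matrix obtained from $C$ by deleting its $2i$-th row and its $2i$-th column. Let $\mu=\mu(q_1,\ldots,q_k)$ be the algebraic connectivity of the caterpillar $T(q_1,\ldots,q_k)$. Then $$\frac{1}{\operatorname{tr}\left((2I_b+C)^{-1}\right)}\le\mu\le\min_{1\le i\le k-1}\frac{1}{\operatorname{tr}\left((2I_b+C)^{-1}\right)-\operatorname{tr}\left((2I_{b-1}+\widetilde C_{(i)})^{-1}\right)}.$$
   Context: For $k\ge 2$ and nonnegative integers $q_1,\ldots,q_k$, the caterpillar $T(q_1,\ldots,q_k)$ is the tree obtained from a path $u_1u_2\cdots u_k$ by attaching $q_i$ new pendant vertices to $u_i$ for each $i$. The algebraic connectivity of a graph is the second smallest eigenvalue of its Laplacian matrix $L=D-A$ ($D$ the diagonal degree matrix, $A$ the adjacency matrix). $C(q_1,\ldots,q_k)$ is the symmetric $(2k-1)\times(2k-1)$ real matrix whose nonzero entries are: $C_{2i-1,2i-1}=\max\{0,q_i-1\}$ for $1\le i\le k$; $C_{2i-1,2i}=C_{2i,2i-1}=\sqrt{q_i}$ and $C_{2i,2i+1}=C_{2i+1,2i}=\sqrt{q_{i+1}}$ for $1\le i\le k-1$; $C_{2i,2i+2}=C_{2i+2,2i}=1$ for $1\le i\le k-2$; all other entries are $0$. $I_m$ is the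 $m\times m$ identity matrix and $\operatorname{tr}$ denotes the trace. *)

theory Defs
  imports
    Complex_Main
    "HOL-Library.Multiset"
    "HOL-Computational_Algebra.Polynomial"
    "Jordan_Normal_Form.Determinant"
    "Jordan_Normal_Form.Gauss_Jordan_Elimination"
    "Jordan_Normal_Form.Char_Poly"
begin

definition mat_trace :: "'a :: comm_monoid_add mat \<Rightarrow> 'a" where
  "mat_trace A = (\<Sum>i<dim_row A. A $$ (i, i))"

text \<open>A finite simple graph is given by its vertex set and its set of edges, each edge being
  the two-element set of its ends. Its matrices are taken with respect to an enumeration
  \<open>vs\<close> of the vertices.\<close>

type_synonym 'v graph = "'v set \<times> 'v set set"

definition vertex_degree :: "'v graph \<Rightarrow> 'v \<Rightarrow> nat" where
  "vertex_degree G v = card {e \<in> snd G. v \<in> e}"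

definition degree_matrix :: "'v graph \<Rightarrow> 'v list \<Rightarrow> real mat" where
  "degree_matrix G vs = mat (length vs) (length vs)
     (\<lambda>(i, j). if i = j then real (vertex_degree G (vs ! i)) else 0)"

definition adjacency_matrix :: "'v graph \<Rightarrow> 'v list \<Rightarrow> real mat" where
  "adjacency_matrix G vs = mat (length vs) (length vs)
     (\<lambda>(i, j). if {vs ! i, vs ! j} \<in> snd G then 1 else 0)"

definition laplacian_matrix :: "'v graph \<Rightarrow> 'v list \<Rightarrow> real mat" where
  "laplacian_matrix G vs = degree_matrix G vs - adjacency_matrix G vs"

text \<open>Real eigenvalues in increasing order, repeated according to multiplicity as roots of the
  characteristic polynomial. For a real symmetric matrix these are all the eigenvalues.\<close>

definition sorted_eigenvalues :: "real mat \<Rightarrow> real list" where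
  "sorted_eigenvalues A = sorted_list_of_multiset (proots (char_poly A))"

text \<open>List positions start at 0, so position 1 holds the second smallest eigenvalue. The choice
  of the enumeration is immaterial, since two enumerations give permutation-similar
  Laplacian matrices.\<close>

definition algebraic_connectivity :: "'v graph \<Rightarrow> real" where
  "algebraic_connectivity G =
     sorted_eigenvalues
       (laplacian_matrix G (SOME vs. distinct vs \<and> set vs = fst G)) ! 1"

text \<open>\<open>Spine i\<close> is the path vertex \<open>u\<^sub>i\<close>, and \<open>Pendant i j\<close> is the \<open>j\<close>-th pendant vertex attached
  to \<open>u\<^sub>i\<close>. The sequence \<open>q\<close> is indexed from 1; only \<open>q 1, \<dots>, q k\<close> are used.\<close>

datatype caterpillar_vertex = Spine nat | Pendant nat nat

definition caterpillar :: "nat \<Rightarrow> (nat \<Rightarrow> nat) \<Rightarrow> caterpillar_vertex graph" where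
  "caterpillar k q =
     ({Spine i | i. i \<in> {1..k}} \<union> {Pendant i j | i j. i \<in> {1..k} \<and> j \<in> {1..q i}},
      {{Spine i, Spine (i + 1)} | i. i \<in> {1..k - 1}} \<union>
      {{Spine i, Pendant i j} | i j. i \<in> {1..k} \<and> j \<in> {1..q i}})"

text \<open>The \<open>(r, s)\<close> entry of \<open>C(q\<^sub>1, \<dots>, q\<^sub>k)\<close>, rows and columns being numbered from 1.\<close>

definition C_entry :: "(nat \<Rightarrow> nat) \<Rightarrow> nat \<Rightarrow> nat \<Rightarrow> real" where
  "C_entry q r s =
     (if odd r \<and> s = r then max 0 (real (q ((r + 1) div 2)) - 1)
      else if odd r \<and> (s = r + 1 \<or> r = s + 1) then sqrt (real (q ((r + 1) div 2)))
      else if even r \<and> (s = r + 1 \<or> r = s + 1) then sqrt (real (q ((s + 1) div 2)))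
      else if even r \<and> (s = r + 2 \<or> r = s + 2) then 1
      else 0)"

text \<open>The library numbers rows and columns from 0.\<close>

definition C_matrix :: "nat \<Rightarrow> (nat \<Rightarrow> nat) \<Rightarrow> real mat" where
  "C_matrix k q = mat (2 * k - 1) (2 * k - 1) (\<lambda>(r, s). C_entry q (r + 1) (s + 1))"

lemma C_entry_values:
  assumes "i \<ge> 1"
  shows "C_entry q (2 * i - 1) (2 * i - 1) = max 0 (real (q i) - 1)"
    and "C_entry q (2 * i - 1) (2 * i) = sqrt (real (q i))"
    and "C_entry q (2 * i) (2 * i - 1) = sqrt (real (q i))"
    and "C_entry q (2 * i) (2 * i + 1) = sqrt (real (q (i + 1)))"
    and "C_entry q (2 * i + 1) (2 * i) = sqrt (real (q (i + 1)))"
    and "C_entry q (2 * i) (2 * i + 2) = 1"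
    and "C_entry q (2 * i + 2) (2 * i) = 1"
  using assms by (auto simp: C_entry_def)

definition C_deleted :: "nat \<Rightarrow> (nat \<Rightarrow> nat) \<Rightarrow> nat \<Rightarrow> real mat" where
  "C_deleted k q i = mat_delete (C_matrix k q) (2 * i - 1) (2 * i - 1)"

text \<open>Meaningful for invertible matrices only.\<close>

definition inverse_mat :: "'a :: field mat \<Rightarrow> 'a mat" where
  "inverse_mat A = the (mat_inverse A)"

end

theory Submission
  imports Defs
begin

text \<open>The oriented incidence matrix of a tree is a matrix \<open>B\<close> with one more row than columns,
  the Laplacian matrix is \<open>B B\<^sup>T\<close>, and \<open>B B\<^sup>T\<close> and \<open>B\<^sup>T B\<close> have the same characteristic
  polynomial up to a factor \<open>X\<close>. Hence \<open>\<mu>\<close> is the smallest eigenvalue of the edge form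
  \<open>x \<mapsto> |B x|\<^sup>2\<close>. For a caterpillar, restricting this form to weights that are constant on the
  pendant edges at each spine vertex gives the form of \<open>M = 2I + C\<close>, and both have the same minimal
  Rayleigh quotient \<open>\<mu>\<close>. The lower bound is \<open>1 / \<mu> \<le> tr M\<^sup>-\<^sup>1\<close>. For the upper bound, deleting
  row and column \<open>p\<close> lowers the trace of the inverse by \<open>w\<^sup>T w / w\<^sup>T M w\<close> with \<open>w = M\<^sup>-\<^sup>1 e\<^sub>p\<close>, the
  reciprocal of a Rayleigh quotient of \<open>M\<close>.\<close>

section \<open>Semidefinite forms and their inverses\<close>

lemma mult_mat_vec_lincomb:
  fixes N :: "real mat"
  assumes "N \<in> carrier_mat m n" "x \<in> carrier_vec n" "y \<in> carrier_vec n"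
  shows "N *\<^sub>v (x + c \<cdot>\<^sub>v y) = N *\<^sub>v x + c \<cdot>\<^sub>v (N *\<^sub>v y)"
  using assms by (simp add: mult_add_distrib_mat_vec[OF assms(1)] mult_mat_vec)

lemma symmetric_form_commute:
  fixes N :: "real mat"
  assumes "N \<in> carrier_mat n n" "N\<^sup>T = N" "x \<in> carrier_vec n" "y \<in> carrier_vec n"
  shows "x \<bullet> (N *\<^sub>v y) = y \<bullet> (N *\<^sub>v x)"
  using transpose_vec_mult_scalar[OF assms(1,4,3)] assms
  by (metis comm_scalar_prod mult_mat_vec_carrier)

lemma form_lincomb:
  fixes N :: "real mat"
  assumes N: "N \<in> carrier_mat n n" "N\<^sup>T = N" and x: "x \<in> carrier_vec n" and y: "y \<in> carrier_vec n"
  shows "(x + t \<cdot>\<^sub>v y) \<bullet> (N *\<^sub>v (x + t \<cdot>\<^sub>v y))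
    = x \<bullet> (N *\<^sub>v x) + 2 * t * (x \<bullet> (N *\<^sub>v y)) + t\<^sup>2 * (y \<bullet> (N *\<^sub>v y))"
proof -
  have Nx: "N *\<^sub>v x \<in> carrier_vec n" "N *\<^sub>v y \<in> carrier_vec n" using N x y by auto
  have "(x + t \<cdot>\<^sub>v y) \<bullet> (N *\<^sub>v (x + t \<cdot>\<^sub>v y))
      = x \<bullet> (N *\<^sub>v x) + t * (x \<bullet> (N *\<^sub>v y)) + t * (y \<bullet> (N *\<^sub>v x)) + t * t * (y \<bullet> (N *\<^sub>v y))"
    using x y Nx N(1)
    by (simp add: mult_mat_vec_lincomb[OF N(1) x y] add_scalar_prod_distrib[of _ n]
        scalar_prod_add_distrib[of _ n] algebra_simps)
  then show ?thesis
    using symmetric_form_commute[OF N x y] by (simp add: power2_eq_square)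
qed

text \<open>The form at \<open>x + t y\<close> is a nonnegative polynomial of degree at most 2 in
  \<open>t\<close>, so its discriminant is at most 0. A vanishing leading coefficient is treated
  apart.\<close>

lemma semidefinite_form_Cauchy_Schwarz:
  fixes N :: "real mat"
  assumes N: "N \<in> carrier_mat n n" "N\<^sup>T = N"
    and psd: "\<And>x. x \<in> carrier_vec n \<Longrightarrow> 0 \<le> x \<bullet> (N *\<^sub>v x)"
    and x: "x \<in> carrier_vec n" and y: "y \<in> carrier_vec n"
  shows "(x \<bullet> (N *\<^sub>v y))\<^sup>2 \<le> (x \<bullet> (N *\<^sub>v x)) * (y \<bullet> (N *\<^sub>v y))"
proof -
  define a b c where "a = x \<bullet> (N *\<^sub>v x)" and "b = x \<bullet> (N *\<^sub>v y)" and "c = y \<bullet> (N *\<^sub>v y)"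
  have q: "0 \<le> a + 2 * t * b + t\<^sup>2 * c" for t
    using psd[of "x + t \<cdot>\<^sub>v y"] form_lincomb[OF N x y] x y by (simp add: a_def b_def c_def)
  have c: "c \<ge> 0" unfolding c_def using psd y by auto
  have "b\<^sup>2 \<le> a * c"
  proof (cases "c = 0")
    case True
    have "b = 0"
    proof (rule ccontr)
      assume "b \<noteq> 0"
      \<comment> \<open>This \<open>t\<close> makes \<open>a + 2 * t * b\<close> equal to
        -1.\<close>
      then show False using q[of "-(a + 1) / (2 * b)"] True by (simp add: field_simps)
    qed
    then show ?thesis using True by simp
  next
    case False
    have "0 \<le> c * (a + 2 * (-b/c) * b + (-b/c)\<^sup>2 * c)" using q[of "-b/c"] c by simp
    also have "\<dots> = a * c - b\<^sup>2" using False by (simp add: field_simps power2_eq_square)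
    finally show ?thesis by simp
  qed
  then show ?thesis by (simp add: a_def b_def c_def)
qed

lemma unit_vec_form:
  fixes N :: "real mat"
  assumes "N \<in> carrier_mat n n" "i < n" "j < n"
  shows "unit_vec n i \<bullet> (N *\<^sub>v unit_vec n j) = N $$ (i, j)"
  using assms by (simp add: scalar_prod_right_unit[of _ n])

lemma form_eq_double_sum:
  fixes N :: "real mat"
  assumes "N \<in> carrier_mat n n" "x \<in> carrier_vec n"
  shows "x \<bullet> (N *\<^sub>v x) = (\<Sum>i<n. \<Sum>j<n. N $$ (i, j) * x $ i * x $ j)"
proof -
  have "x \<bullet> (N *\<^sub>v x) = (\<Sum>i<n. x $ i * (\<Sum>j<n. N $$ (i, j) * x $ j))"
    using assms unfolding scalar_prod_def by (intro sum.cong) (auto simp: scalar_prod_def atLeast0LessThan)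
  then show ?thesis by (simp add: sum_distrib_left mult_ac)
qed

text \<open>The trace dominates the largest eigenvalue. Instead of a spectral decomposition,
  Cauchy-Schwarz on unit vectors bounds each entry by the diagonal, and the inequality of arithmetic
  and geometric means splits the products.\<close>

lemma semidefinite_form_le_trace:
  fixes W :: "real mat"
  assumes W: "W \<in> carrier_mat n n" "W\<^sup>T = W"
    and psd: "\<And>x. x \<in> carrier_vec n \<Longrightarrow> 0 \<le> x \<bullet> (W *\<^sub>v x)"
    and x: "x \<in> carrier_vec n"
  shows "x \<bullet> (W *\<^sub>v x) \<le> (x \<bullet> x) * mat_trace W"
proof -
  have diag: "0 \<le> W $$ (i, i)" if "i < n" for i
    using psd[of "unit_vec n i"] unit_vec_form[OF W(1) that that] by simp
  have entry: "\<bar>W $$ (i, j)\<bar> \<le> sqrt (W $$ (i, i)) * sqrt (W $$ (j, j))" if "i < n" "j < n" for i j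
  proof -
    have "(W $$ (i, j))\<^sup>2 \<le> W $$ (i, i) * W $$ (j, j)"
      using semidefinite_form_Cauchy_Schwarz[OF W psd, of "unit_vec n i" "unit_vec n j"]
        unit_vec_form[OF W(1)] that by simp
    then show ?thesis
      by (metis real_sqrt_abs real_sqrt_le_mono real_sqrt_mult)
  qed
  have "x \<bullet> (W *\<^sub>v x) = (\<Sum>i<n. \<Sum>j<n. W $$ (i, j) * x $ i * x $ j)"
    by (rule form_eq_double_sum[OF W(1) x])
  also have "\<dots> \<le> (\<Sum>i<n. \<Sum>j<n. ((x $ i)\<^sup>2 * W $$ (j, j) + (x $ j)\<^sup>2 * W $$ (i, i)) / 2)"
  proof (intro sum_mono)
    fix i j assume ij: "i \<in> {..<n}" "j \<in> {..<n}"
    \<comment> \<open>Pairing \<open>x $ i\<close> with the diagonal entry at \<open>j\<close> makes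
      the final double sum factor into squared norm times trace.\<close>
    define u v where "u = \<bar>x $ i\<bar> * sqrt (W $$ (j, j))" and "v = \<bar>x $ j\<bar> * sqrt (W $$ (i, i))"
    have "W $$ (i, j) * x $ i * x $ j \<le> \<bar>W $$ (i, j)\<bar> * (\<bar>x $ i\<bar> * \<bar>x $ j\<bar>)"
      by (metis abs_ge_self abs_mult mult.assoc)
    also have "\<dots> \<le> (sqrt (W $$ (i, i)) * sqrt (W $$ (j, j))) * (\<bar>x $ i\<bar> * \<bar>x $ j\<bar>)"
      using entry ij by (intro mult_right_mono) auto
    also have "\<dots> = u * v" by (simp add: u_def v_def)
    also have "\<dots> \<le> (u\<^sup>2 + v\<^sup>2) / 2" using sum_squares_bound[of u v] by simp
    also have "u\<^sup>2 = (x $ i)\<^sup>2 * W $$ (j, j)" using diag ij by (simp add: u_def power_mult_distrib)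
    also have "v\<^sup>2 = (x $ j)\<^sup>2 * W $$ (i, i)" using diag ij by (simp add: v_def power_mult_distrib)
    finally show "W $$ (i, j) * x $ i * x $ j \<le> ((x $ i)\<^sup>2 * W $$ (j, j) + (x $ j)\<^sup>2 * W $$ (i, i)) / 2" .
  qed
  also have "\<dots> = (\<Sum>i<n. (x $ i)\<^sup>2) * (\<Sum>j<n. W $$ (j, j))"
  proof -
    have "(\<Sum>i<n. \<Sum>j<n. (x $ j)\<^sup>2 * W $$ (i, i)) = (\<Sum>i<n. \<Sum>j<n. (x $ i)\<^sup>2 * W $$ (j, j))"
      by (rule sum.swap)
    then show ?thesis
      by (simp add: sum_product sum.distrib flip: sum_divide_distrib)
  qed
  also have "\<dots> = (x \<bullet> x) * mat_trace W"
    using W x by (simp add: scalar_prod_def mat_trace_def power2_eq_square atLeast0LessThan)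
  finally show ?thesis .
qed

lemma inverse_of_symmetric:
  fixes N :: "real mat"
  assumes N: "N \<in> carrier_mat n n" "N\<^sup>T = N" and W: "W \<in> carrier_mat n n" and NW: "N * W = 1\<^sub>m n"
  shows "W\<^sup>T = W" "W * N = 1\<^sub>m n"
proof -
  show WN: "W * N = 1\<^sub>m n" using mat_mult_left_right_inverse[OF N(1) W NW] .
  have "W\<^sup>T * N = 1\<^sub>m n"
    using arg_cong[OF NW, of transpose_mat] transpose_mult[OF N(1) W] N by simp
  then have "W\<^sup>T * (N * W) = W"
    using N W by (simp flip: assoc_mult_mat[of _ n n _ n _ n])
  then show "W\<^sup>T = W" using NW W by simp
qed

text \<open>Cauchy-Schwarz for \<open>N\<close> at \<open>x\<close> and \<open>W x\<close> bounds
  the square of \<open>x . x\<close> by the product of \<open>x . N x\<close> and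
  \<open>x . W x\<close>, and the trace of \<open>W\<close> controls the last factor. So every
  Rayleigh quotient of \<open>N\<close> is at least \<open>1 / tr W\<close>.\<close>

lemma sum_squares_le_form_times_trace_inverse:
  fixes N :: "real mat"
  assumes N: "N \<in> carrier_mat n n" "N\<^sup>T = N"
    and psd: "\<And>x. x \<in> carrier_vec n \<Longrightarrow> 0 \<le> x \<bullet> (N *\<^sub>v x)"
    and W: "W \<in> carrier_mat n n" and NW: "N * W = 1\<^sub>m n"
    and x: "x \<in> carrier_vec n"
  shows "x \<bullet> x \<le> (x \<bullet> (N *\<^sub>v x)) * mat_trace W"
proof -
  note Wsym = inverse_of_symmetric(1)[OF N W NW]
  have NWv: "N *\<^sub>v (W *\<^sub>v y) = y" if "y \<in> carrier_vec n" for y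
    using that N W NW by (metis assoc_mult_mat_vec one_mult_mat_vec)
  have Wpsd: "0 \<le> y \<bullet> (W *\<^sub>v y)" if y: "y \<in> carrier_vec n" for y
    using psd[of "W *\<^sub>v y"] NWv[OF y] W y comm_scalar_prod[of y n "W *\<^sub>v y"] by simp
  have "(x \<bullet> x)\<^sup>2 = (x \<bullet> (N *\<^sub>v (W *\<^sub>v x)))\<^sup>2" by (simp add: NWv x)
  also have "\<dots> \<le> (x \<bullet> (N *\<^sub>v x)) * ((W *\<^sub>v x) \<bullet> (N *\<^sub>v (W *\<^sub>v x)))"
    using W x by (intro semidefinite_form_Cauchy_Schwarz[OF N psd]) auto
  also have "(W *\<^sub>v x) \<bullet> (N *\<^sub>v (W *\<^sub>v x)) = x \<bullet> (W *\<^sub>v x)"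
    using comm_scalar_prod[of x n "W *\<^sub>v x"] W x by (simp add: NWv)
  also have "(x \<bullet> (N *\<^sub>v x)) * (x \<bullet> (W *\<^sub>v x)) \<le> (x \<bullet> (N *\<^sub>v x)) * ((x \<bullet> x) * mat_trace W)"
    using semidefinite_form_le_trace[OF W Wsym Wpsd x] psd[OF x] by (rule mult_left_mono)
  finally have *: "(x \<bullet> x) * (x \<bullet> x) \<le> (x \<bullet> x) * ((x \<bullet> (N *\<^sub>v x)) * mat_trace W)"
    by (simp add: power2_eq_square mult_ac)
  have nn: "0 \<le> x \<bullet> x" by (simp add: scalar_prod_def sum_nonneg)
  show ?thesis
  proof (cases "x \<bullet> x = 0")
    case True
    have "0 \<le> mat_trace W"
    proof -
      have "0 \<le> W $$ (i, i)" if "i < n" for i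
        using Wpsd[of "unit_vec n i"] unit_vec_form[OF W that that] by simp
      then show ?thesis using W by (auto simp: mat_trace_def intro!: sum_nonneg)
    qed
    then show ?thesis using True psd[OF x] by simp
  next
    case False
    then show ?thesis using * nn by (simp add: mult_le_cancel_left)
  qed
qed

lemma scalar_prod_self_pos:
  fixes x :: "real vec"
  assumes "x \<in> carrier_vec n" "x \<noteq> 0\<^sub>v n"
  shows "0 < x \<bullet> x"
proof -
  obtain i where i: "i < n" "x $ i \<noteq> 0" using assms by (metis carrier_vecD eq_vecI index_zero_vec)
  have "0 < x $ i * x $ i" using i by (simp add: zero_less_mult_iff) linarith
  then show ?thesis unfolding scalar_prod_def using i assms
    by (intro sum_pos2[of _ i]) auto
qed

lemma injective_mat_right_inverse:
  fixes N :: "real mat"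
  assumes N: "N \<in> carrier_mat n n"
    and inj: "\<And>x. x \<in> carrier_vec n \<Longrightarrow> N *\<^sub>v x = 0\<^sub>v n \<Longrightarrow> x = 0\<^sub>v n"
  obtains W where "W \<in> carrier_mat n n" "N * W = 1\<^sub>m n"
proof -
  have "det N \<noteq> 0" using det_0_iff_vec_prod_zero_field[OF N] inj by auto
  then have "N \<in> Units (ring_mat TYPE(real) n ())" by (rule det_non_zero_imp_unit[OF N])
  then show ?thesis using that unfolding Units_def ring_mat_def by auto
qed

text \<open>The infimum \<open>\<lambda>\<close> of the Rayleigh quotient is attained: otherwise \<open>K - \<lambda>\<close> would be invertible
  and semidefinite, hence bounded below by \<open>1 / tr ((K - \<lambda>)\<^sup>-\<^sup>1) > 0\<close>.\<close>

lemma smallest_eigenvector_exists: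
  fixes K :: "real mat"
  assumes K: "K \<in> carrier_mat n n" "K\<^sup>T = K" and n: "n > 0"
    and psd: "\<And>x. x \<in> carrier_vec n \<Longrightarrow> 0 \<le> x \<bullet> (K *\<^sub>v x)"
  obtains x l where "eigenvector K x l"
    "\<And>y. y \<in> carrier_vec n \<Longrightarrow> l * (y \<bullet> y) \<le> y \<bullet> (K *\<^sub>v y)"
proof -
  define R where "R = {(x \<bullet> (K *\<^sub>v x)) / (x \<bullet> x) | x. x \<in> carrier_vec n \<and> x \<noteq> 0\<^sub>v n}"
  define l where "l = Inf R"
  have nz: "unit_vec n 0 \<noteq> (0\<^sub>v n :: real vec)" using n by simp
  have Rne: "R \<noteq> {}" unfolding R_def using nz unit_vec_carrier[of n 0] by blast
  have bdd: "bdd_below R"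
    unfolding R_def bdd_below_def using psd scalar_prod_self_pos by (intro exI[of _ 0]) force
  have low: "l * (y \<bullet> y) \<le> y \<bullet> (K *\<^sub>v y)" if y: "y \<in> carrier_vec n" for y
  proof (cases "y = 0\<^sub>v n")
    case True then show ?thesis using psd[OF y] by simp
  next
    case False
    then have "l \<le> (y \<bullet> (K *\<^sub>v y)) / (y \<bullet> y)"
      unfolding l_def using y bdd by (intro cInf_lower) (auto simp: R_def)
    then show ?thesis using scalar_prod_self_pos[OF y False] by (simp add: pos_le_divide_eq)
  qed
  define N where "N = K + (- l) \<cdot>\<^sub>m 1\<^sub>m n"
  have N: "N \<in> carrier_mat n n" using K by (simp add: N_def)
  have "(- l \<cdot>\<^sub>m 1\<^sub>m n)\<^sup>T = - l \<cdot>\<^sub>m 1\<^sub>m n" by (rule eq_matI) auto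
  then have Nsym: "N\<^sup>T = N" using K unfolding N_def by (simp add: transpose_add[of _ n n])
  have Nx: "N *\<^sub>v x = K *\<^sub>v x + (- l) \<cdot>\<^sub>v x" if "x \<in> carrier_vec n" for x
  proof -
    have "(- l \<cdot>\<^sub>m 1\<^sub>m n) *\<^sub>v x = - l \<cdot>\<^sub>v x" using that by (intro eq_vecI) auto
    then show ?thesis
      unfolding N_def using K that by (simp add: add_mult_distrib_mat_vec[of _ n n])
  qed
  have Nform: "x \<bullet> (N *\<^sub>v x) = x \<bullet> (K *\<^sub>v x) - l * (x \<bullet> x)" if "x \<in> carrier_vec n" for x
    using that K by (simp add: Nx scalar_prod_add_distrib[of _ n])
  have "\<exists>x. x \<in> carrier_vec n \<and> x \<noteq> 0\<^sub>v n \<and> N *\<^sub>v x = 0\<^sub>v n"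
  proof (rule ccontr)
    assume "\<nexists>x. x \<in> carrier_vec n \<and> x \<noteq> 0\<^sub>v n \<and> N *\<^sub>v x = 0\<^sub>v n"
    then obtain W where W: "W \<in> carrier_mat n n" "N * W = 1\<^sub>m n"
      using injective_mat_right_inverse[OF N] by metis
    have bound: "x \<bullet> x \<le> (x \<bullet> (K *\<^sub>v x) - l * (x \<bullet> x)) * mat_trace W" if "x \<in> carrier_vec n" for x
      using sum_squares_le_form_times_trace_inverse[OF N Nsym _ W that] Nform low that by simp
    have pos: "mat_trace W > 0"
    proof -
      have e: "unit_vec n 0 \<in> carrier_vec n" by simp
      show ?thesis using bound[OF e] low[OF e] scalar_prod_self_pos[OF e nz]
        by (smt (verit) mult_nonneg_nonpos)
    qed
    have "l + 1 / mat_trace W \<le> l"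
    proof (subst (2) l_def, rule cInf_greatest[OF Rne])
      fix r assume "r \<in> R"
      then obtain x where x: "x \<in> carrier_vec n" "x \<noteq> 0\<^sub>v n" and r: "r = (x \<bullet> (K *\<^sub>v x)) / (x \<bullet> x)"
        unfolding R_def by auto
      show "l + 1 / mat_trace W \<le> r"
        using bound[OF x(1)] scalar_prod_self_pos[OF x] pos unfolding r by (simp add: field_simps)
    qed
    then show False using pos by simp
  qed
  then obtain x where x: "x \<in> carrier_vec n" "x \<noteq> 0\<^sub>v n" "N *\<^sub>v x = 0\<^sub>v n" by auto
  have "K *\<^sub>v x = l \<cdot>\<^sub>v x"
  proof (rule eq_vecI)
    fix i assume i: "i < dim_vec (l \<cdot>\<^sub>v x)"
    then have "(K *\<^sub>v x + (- l) \<cdot>\<^sub>v x) $ i = 0" using x Nx[OF x(1)] by auto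
    then show "(K *\<^sub>v x) $ i = (l \<cdot>\<^sub>v x) $ i" using i x K by simp
  qed (use x K in auto)
  then have "eigenvector K x l" using x K by (simp add: eigenvector_def)
  then show ?thesis using that low by blast
qed

section \<open>Gram matrices and the second smallest eigenvalue\<close>

text \<open>The determinant of the block matrix \<open>F\<close> with rows \<open>(X I, P)\<close>
  and \<open>(Q, I)\<close> is computed twice. Multiplying by \<open>G\<close> on the right or by
  \<open>H\<close> on the left clears the lower left block, and the remaining diagonal block is the
  characteristic matrix of \<open>A * B\<close> or of \<open>B * A\<close>.\<close>

lemma char_poly_mult_swap:
  fixes A B :: "'a :: field mat"
  assumes A: "A \<in> carrier_mat n m" and B: "B \<in> carrier_mat m n"
  shows "[:0, 1:] ^ m * char_poly (A * B) = [:0, 1:] ^ n * char_poly (B * A)"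
proof -
  let ?X = "[:0, 1:] :: 'a poly"
  define P Q where "P = map_mat (\<lambda>a. [:a:]) A" and "Q = map_mat (\<lambda>a. [:a:]) B"
  have P: "P \<in> carrier_mat n m" and Q: "Q \<in> carrier_mat m n" using A B by (auto simp: P_def Q_def)
  define F where "F = four_block_mat (?X \<cdot>\<^sub>m 1\<^sub>m n) P Q (1\<^sub>m m)"
  have F: "F \<in> carrier_mat (n + m) (n + m)" unfolding F_def by simp
  interpret h: semiring_hom "\<lambda>a :: 'a. [:a:]" by standard (auto simp: one_pCons)
  have cAB: "char_poly_matrix (A * B) = ?X \<cdot>\<^sub>m 1\<^sub>m n + - (P * Q)"
  proof -
    have "map_mat (\<lambda>a. [:- a:]) (A * B) = - map_mat (\<lambda>a. [:a:]) (A * B)" using A B by (intro eq_matI) auto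
    then show ?thesis using A B h.mat_hom_mult[OF A B] by (simp add: char_poly_matrix_def P_def Q_def)
  qed
  have cBA: "char_poly_matrix (B * A) = ?X \<cdot>\<^sub>m 1\<^sub>m m + - (Q * P)"
  proof -
    have "map_mat (\<lambda>a. [:- a:]) (B * A) = - map_mat (\<lambda>a. [:a:]) (B * A)" using A B by (intro eq_matI) auto
    then show ?thesis using A B h.mat_hom_mult[OF B A] by (simp add: char_poly_matrix_def P_def Q_def)
  qed
  define G where "G = four_block_mat (1\<^sub>m n) (0\<^sub>m n m) (- Q) (1\<^sub>m m)"
  define H where "H = four_block_mat (1\<^sub>m n) (0\<^sub>m n m) (- Q) (?X \<cdot>\<^sub>m 1\<^sub>m m)"
  have G: "G \<in> carrier_mat (n + m) (n + m)" and H: "H \<in> carrier_mat (n + m) (n + m)"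
    unfolding G_def H_def by simp_all
  have "F * G = four_block_mat (?X \<cdot>\<^sub>m 1\<^sub>m n + - (P * Q)) P (0\<^sub>m m n) (1\<^sub>m m)"
    unfolding F_def G_def using P Q
    by (subst mult_four_block_mat[of _ n n _ m _ m _ _ n _ m]) auto
  moreover have "det G = 1" unfolding G_def using Q
    by (subst det_four_block_mat_upper_right_zero[of _ n _ m]) auto
  ultimately have FG: "det F = char_poly (A * B)"
    using det_mult[OF F G] P Q cAB
    by (simp add: char_poly_def det_four_block_mat_lower_left_zero[of _ n _ m])
  have "H * F = four_block_mat (?X \<cdot>\<^sub>m 1\<^sub>m n) P (0\<^sub>m m n) (?X \<cdot>\<^sub>m 1\<^sub>m m + - (Q * P))"
    unfolding F_def H_def using P Q
    by (subst mult_four_block_mat[of _ n n _ m _ m _ _ n _ m]) (auto simp: comm_add_mat[of _ m m])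
  moreover have "det H = ?X ^ m" unfolding H_def using Q
    by (subst det_four_block_mat_upper_right_zero[of _ n _ m]) auto
  ultimately have "?X ^ m * det F = ?X ^ n * char_poly (B * A)"
    using det_mult[OF H F] P Q cBA
    by (simp add: char_poly_def det_four_block_mat_lower_left_zero[of _ n _ m])
  then show ?thesis by (simp add: FG)
qed

text \<open>The roots for \<open>B * B\<^sup>T\<close> are those for the smaller Gram matrix
  \<open>K\<close>, together with one extra 0. Hence position 1 holds the least eigenvalue of
  \<open>K\<close>, which is the minimum of its Rayleigh quotient.\<close>

lemma sorted_eigenvalues_gram_second:
  fixes B :: "real mat"
  assumes B: "B \<in> carrier_mat (Suc m) m" and m: "m > 0"
  defines "\<mu> \<equiv> sorted_eigenvalues (B * B\<^sup>T) ! 1"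
  shows "\<And>y. y \<in> carrier_vec m \<Longrightarrow> \<mu> * (y \<bullet> y) \<le> (B *\<^sub>v y) \<bullet> (B *\<^sub>v y)"
    and "\<exists>x \<in> carrier_vec m. x \<noteq> 0\<^sub>v m \<and> (B *\<^sub>v x) \<bullet> (B *\<^sub>v x) = \<mu> * (x \<bullet> x)"
proof -
  define K where "K = B\<^sup>T * B"
  have K: "K \<in> carrier_mat m m" using B by (simp add: K_def)
  have Ksym: "K\<^sup>T = K" unfolding K_def using B transpose_mult[of "B\<^sup>T" m "Suc m" B m] by simp
  have form: "y \<bullet> (K *\<^sub>v y) = (B *\<^sub>v y) \<bullet> (B *\<^sub>v y)" if y: "y \<in> carrier_vec m" for y
  proof -
    have "K *\<^sub>v y = B\<^sup>T *\<^sub>v (B *\<^sub>v y)" unfolding K_def using B y by simp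
    then have "y \<bullet> (K *\<^sub>v y) = (B\<^sup>T *\<^sub>v (B *\<^sub>v y)) \<bullet> y"
      using comm_scalar_prod[of y m "K *\<^sub>v y"] K y mult_mat_vec_carrier[OF K y] by simp
    also have "\<dots> = (B *\<^sub>v y) \<bullet> (B *\<^sub>v y)"
      using transpose_vec_mult_scalar[OF B y, of "B *\<^sub>v y"] B y by simp
    finally show ?thesis .
  qed
  have sq: "0 \<le> v \<bullet> v" for v :: "real vec" by (simp add: scalar_prod_def sum_nonneg)
  obtain x l where xl: "eigenvector K x l"
    and low: "\<And>y. y \<in> carrier_vec m \<Longrightarrow> l * (y \<bullet> y) \<le> y \<bullet> (K *\<^sub>v y)"
    using smallest_eigenvector_exists[OF K Ksym m] form sq by metis
  have val: "y \<in> carrier_vec m \<and> y \<noteq> 0\<^sub>v m \<and> y \<bullet> (K *\<^sub>v y) = r * (y \<bullet> y)"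
    if "eigenvector K y r" for y r
    using that K unfolding eigenvector_def by auto
  have "[:0, 1:] ^ m * char_poly (B * B\<^sup>T) = [:0, 1:] ^ m * ([:0, 1:] * char_poly K)"
    using char_poly_mult_swap[of B "Suc m" m "B\<^sup>T"] B by (simp add: K_def mult_ac)
  then have cp: "char_poly (B * B\<^sup>T) = [:0, 1:] * char_poly K"
    by (subst (asm) mult_cancel_left) auto
  have nz: "char_poly K \<noteq> 0" using degree_monic_char_poly[OF K] by auto
  have pr: "proots (char_poly (B * B\<^sup>T)) = add_mset 0 (proots (char_poly K))"
    unfolding cp using nz by (subst proots_mult) auto
  define S where "S = sorted_list_of_multiset (proots (char_poly K))"
  have setS: "set S = {r. eigenvalue K r}"
    unfolding S_def using nz eigenvalue_root_char_poly[OF K] by simp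
  have lS: "l \<in> set S" using xl unfolding setS eigenvalue_def by auto
  have minS: "l \<le> r" if r: "r \<in> set S" for r
  proof -
    obtain y where "eigenvector K y r" using r unfolding setS eigenvalue_def by auto
    from val[OF this] low[of y] scalar_prod_self_pos[of y m] show ?thesis by auto
  qed
  \<comment> \<open>Nonnegativity lets the extra root 0 sort in front, which leaves \<open>l\<close>
    at position 1.\<close>
  have l0: "0 \<le> l"
    using val[OF xl] form[of x] sq[of "B *\<^sub>v x"] scalar_prod_self_pos[of x m]
    by (metis mult.commute zero_le_mult_iff not_le)
  obtain s S' where S: "S = s # S'" using lS by (cases S) auto
  have "sorted S" unfolding S_def by simp
  then have "s = l" using S lS minS[of s] by auto
  then have "\<mu> = l"
    unfolding \<mu>_def sorted_eigenvalues_def pr using S l0 by (simp add: S_def)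
  then show "\<And>y. y \<in> carrier_vec m \<Longrightarrow> \<mu> * (y \<bullet> y) \<le> (B *\<^sub>v y) \<bullet> (B *\<^sub>v y)"
    and "\<exists>x \<in> carrier_vec m. x \<noteq> 0\<^sub>v m \<and> (B *\<^sub>v x) \<bullet> (B *\<^sub>v x) = \<mu> * (x \<bullet> x)"
    using low form val[OF xl] by auto
qed

section \<open>Inverses after deleting a row and a column\<close>

lemma inverse_mat_eqI:
  fixes N :: "real mat"
  assumes N: "N \<in> carrier_mat n n" and W: "W \<in> carrier_mat n n" and NW: "N * W = 1\<^sub>m n"
  shows "inverse_mat N = W"
proof -
  have "N \<in> Units (ring_mat TYPE(real) n ())"
    unfolding Units_def ring_mat_def using N W NW mat_mult_left_right_inverse[OF N W NW] by auto
  then obtain V where V: "mat_inverse N = Some V" using mat_inverse(1)[OF N, where b = "()"] by (cases "mat_inverse N") auto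
  note VN = mat_inverse(2)[OF N V]
  have "V = V * (N * W)" unfolding NW using VN right_mult_one_mat[of V n n] by simp
  also have "\<dots> = W" using VN N W by (simp flip: assoc_mult_mat[of _ n n _ n _ n])
  finally show ?thesis by (simp add: inverse_mat_def V)
qed

text \<open>\<open>insert_index p\<close> enumerates the indices other than \<open>p\<close>, so
  sums over a deleted matrix become full sums with one term removed.\<close>

lemma sum_insert_index:
  fixes f :: "nat \<Rightarrow> real"
  assumes "p < Suc n"
  shows "(\<Sum>l<n. f (insert_index p l)) = (\<Sum>l<Suc n. f l) - f p"
proof -
  have "(\<Sum>l<n. f (insert_index p l)) = sum f ({0..<Suc n} - {p})"
    unfolding insert_index_image[OF assms, symmetric]
    by (simp add: sum.reindex[OF insert_index_inj_on] atLeast0LessThan)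
  then show ?thesis using assms by (simp add: sum_diff1 atLeast0LessThan)
qed

text \<open>Deleting row and column \<open>p\<close> from \<open>M\<close> changes the inverse by the rank-one matrix
  \<open>w w\<^sup>T / w\<^sub>p\<close>, where \<open>w\<close> is the \<open>p\<close>-th column of \<open>M\<^sup>-\<^sup>1\<close>.\<close>

lemma trace_inverse_mat_delete:
  fixes M :: "real mat"
  assumes M: "M \<in> carrier_mat (Suc n) (Suc n)" "M\<^sup>T = M"
    and W: "W \<in> carrier_mat (Suc n) (Suc n)" and MW: "M * W = 1\<^sub>m (Suc n)"
    and p: "p < Suc n" and Wpp: "W $$ (p, p) \<noteq> 0"
  shows "mat_trace W - mat_trace (inverse_mat (mat_delete M p p)) = (col W p \<bullet> col W p) / W $$ (p, p)"
proof -
  let ?i = "insert_index p"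
  have ins: "?i i < Suc n" if "i < n" for i using that by (simp add: insert_index_def)
  define V where "V = mat n n (\<lambda>(i, j). W $$ (?i i, ?i j) - W $$ (?i i, p) * W $$ (p, ?i j) / W $$ (p, p))"
  have MWs: "(\<Sum>l<Suc n. M $$ (i, l) * W $$ (l, j)) = (if i = j then 1 else 0)" if "i < Suc n" "j < Suc n" for i j
    using arg_cong[OF MW, of "\<lambda>A. A $$ (i, j)"] that M W by (simp add: scalar_prod_def atLeast0LessThan)
  have Wsym: "W $$ (i, j) = W $$ (j, i)" if "i < Suc n" "j < Suc n" for i j
    using inverse_of_symmetric(1)[OF M W MW] that W by (metis carrier_matD index_transpose_mat(1))
  have "mat_delete M p p * V = 1\<^sub>m n"
  proof (rule eq_matI)
    fix i j assume "i < dim_row (1\<^sub>m n)" "j < dim_col (1\<^sub>m n)"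
    then have ij: "i < n" "j < n" by auto
    have "(mat_delete M p p * V) $$ (i, j) = (\<Sum>l<n. mat_delete M p p $$ (i, l) * V $$ (l, j))"
      using ij M by (simp add: scalar_prod_def atLeast0LessThan V_def)
    also have "\<dots> = (\<Sum>l<n. M $$ (?i i, ?i l) * (W $$ (?i l, ?i j) - W $$ (?i l, p) * W $$ (p, ?i j) / W $$ (p, p)))"
      using ij by (intro sum.cong) (auto simp: V_def mat_delete_index[OF M(1) p p])
    also have "\<dots> = (\<Sum>l<Suc n. M $$ (?i i, l) * (W $$ (l, ?i j) - W $$ (l, p) * W $$ (p, ?i j) / W $$ (p, p)))
       - M $$ (?i i, p) * (W $$ (p, ?i j) - W $$ (p, p) * W $$ (p, ?i j) / W $$ (p, p))"
      by (rule sum_insert_index[OF p])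
    \<comment> \<open>The removed term is 0, because the bracket vanishes at
      \<open>l = p\<close>.\<close>
    also have "\<dots> = (\<Sum>l<Suc n. M $$ (?i i, l) * W $$ (l, ?i j)) - (\<Sum>l<Suc n. M $$ (?i i, l) * W $$ (l, p)) * (W $$ (p, ?i j) / W $$ (p, p))"
      using Wpp by (simp only: sum_distrib_right sum_subtractf[symmetric]) (simp add: algebra_simps)
    \<comment> \<open>Both sums are entries of \<open>M * W\<close>; the second is off the diagonal,
      since \<open>insert_index p\<close> never takes the value \<open>p\<close>.\<close>
    also have "\<dots> = 1\<^sub>m n $$ (i, j)"
      using MWs[OF ins[OF ij(1)] ins[OF ij(2)]] MWs[OF ins[OF ij(1)] p] ij insert_index_inj_on[of p UNIV]
      by (auto dest: injD)
    finally show "(mat_delete M p p * V) $$ (i, j) = 1\<^sub>m n $$ (i, j)" .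
  qed (use M in \<open>auto simp: V_def\<close>)
  then have "inverse_mat (mat_delete M p p) = V"
    using mat_delete_carrier[OF M(1), of p p] by (intro inverse_mat_eqI[of _ n]) (auto simp: V_def)
  moreover have "mat_trace V = mat_trace W - (col W p \<bullet> col W p) / W $$ (p, p)"
  proof -
    have "mat_trace V = (\<Sum>l<n. W $$ (?i l, ?i l) - W $$ (?i l, p) * W $$ (p, ?i l) / W $$ (p, p))"
      by (simp add: mat_trace_def V_def)
    \<comment> \<open>Again the summand at \<open>l = p\<close> vanishes.\<close>
    also have "\<dots> = (\<Sum>l<Suc n. W $$ (l, l) - W $$ (l, p) * W $$ (p, l) / W $$ (p, p))"
      using Wpp by (subst sum_insert_index[OF p]) simp
    also have "\<dots> = (\<Sum>l<Suc n. W $$ (l, l) - W $$ (l, p) * W $$ (l, p) / W $$ (p, p))"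
      using Wsym p by (intro sum.cong refl) (metis lessThan_iff)
    also have "\<dots> = (\<Sum>l<Suc n. W $$ (l, l)) - (\<Sum>l<Suc n. W $$ (l, p) * W $$ (l, p)) / W $$ (p, p)"
      by (simp only: sum_subtractf sum_divide_distrib)
    also have "\<dots> = mat_trace W - (col W p \<bullet> col W p) / W $$ (p, p)"
      using W p by (simp add: mat_trace_def scalar_prod_def atLeast0LessThan)
    finally show ?thesis .
  qed
  ultimately show ?thesis by simp
qed

section \<open>The edge form of a rooted tree\<close>

text \<open>The edge \<open>{v, par v}\<close> is indexed by its lower end \<open>v \<in> I\<close>. No signs occur: with a sign \<open>\<epsilon>\<close> that
  alternates along edges, \<open>\<epsilon> u ([u = v] + [u = par v])\<close> is an oriented incidence matrix, and the factor
  \<open>\<epsilon> u\<close> of a row does not affect the squared norm.\<close>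

definition edge_form :: "'v set \<Rightarrow> 'v set \<Rightarrow> ('v \<Rightarrow> 'v) \<Rightarrow> ('v \<Rightarrow> real) \<Rightarrow> real" where
  "edge_form V I par x = (\<Sum>u\<in>V. (\<Sum>v\<in>I. (of_bool (u = v) + of_bool (u = par v)) * x v)\<^sup>2)"

lemma sum_nth_distinct:
  assumes "distinct xs"
  shows "(\<Sum>j<length xs. f (xs ! j)) = sum f (set xs)"
  using sum.reindex_bij_betw[OF bij_betw_nth[OF assms refl refl], of f] .

text \<open>Naming edges by their lower ends gives one edge for each vertex except the root, so the
  signed incidence matrix \<open>B\<close> has the shape required for the Gram matrix result. It
  remains to check \<open>L = B * B\<^sup>T\<close> entry by entry and to pass between vectors and
  functions on \<open>I\<close>.\<close>

lemma algebraic_connectivity_rooted_tree: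
  fixes G :: "'v graph" and par :: "'v \<Rightarrow> 'v" and \<epsilon> :: "'v \<Rightarrow> real"
  assumes V: "finite (fst G)" "r \<in> fst G" and I: "I = fst G - {r}" "I \<noteq> {}"
    and E: "snd G = (\<lambda>v. {v, par v}) ` I" "inj_on (\<lambda>v. {v, par v}) I"
    and eps: "\<And>v. \<epsilon> v * \<epsilon> v = 1" "\<And>v. v \<in> I \<Longrightarrow> \<epsilon> (par v) = - \<epsilon> v"
  defines "\<mu> \<equiv> algebraic_connectivity G"
  shows "\<And>x. \<mu> * (\<Sum>v\<in>I. (x v)\<^sup>2) \<le> edge_form (fst G) I par x"
    and "\<exists>x. (\<exists>v\<in>I. x v \<noteq> 0) \<and> edge_form (fst G) I par x = \<mu> * (\<Sum>v\<in>I. (x v)\<^sup>2)"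
proof -
  define vs where "vs = (SOME vs. distinct vs \<and> set vs = fst G)"
  have vs: "distinct vs" "set vs = fst G"
    using someI_ex[of "\<lambda>vs. distinct vs \<and> set vs = fst G"] finite_distinct_list[OF V(1)]
    unfolding vs_def by auto
  have "finite I" using V(1) I(1) by simp
  then obtain es where es: "distinct es" "set es = I" using finite_distinct_list[of I] by blast
  define m where "m = length es"
  have m: "m > 0" using es(2) I(2) unfolding m_def by (cases es) auto
  have n: "length vs = Suc m"
    using card.remove[OF V] distinct_card[OF vs(1)] distinct_card[OF es(1)] vs(2) es(2) I(1)
    unfolding m_def by simp
  define inc :: "'v \<Rightarrow> 'v \<Rightarrow> real" where "inc u v = of_bool (u = v) + of_bool (u = par v)" for u v
  define B where "B = mat (Suc m) m (\<lambda>(i, j). \<epsilon> (vs ! i) * inc (vs ! i) (es ! j))"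
  have B: "B \<in> carrier_mat (Suc m) m" by (simp add: B_def)
  have card_sum: "(\<Sum>v\<in>I. of_bool (P v)) = real (card {v \<in> I. P v})" for P
    using \<open>finite I\<close> by (simp add: sum_of_bool_eq Int_def)
  have par_ne: "par v \<noteq> v" if "v \<in> I" for v
  proof
    assume "par v = v"
    with eps(2)[OF that] have "\<epsilon> v = 0" by simp
    with eps(1)[of v] show False by simp
  qed
  have L: "laplacian_matrix G vs = B * B\<^sup>T"
  proof (rule eq_matI)
    fix i i' assume "i < dim_row (B * B\<^sup>T)" "i' < dim_col (B * B\<^sup>T)"
    then have ii: "i < Suc m" "i' < Suc m" by (auto simp: B_def)
    define u u' where "u = vs ! i" and "u' = vs ! i'"
    have "(B * B\<^sup>T) $$ (i, i') = (\<Sum>j<m. (\<epsilon> u * inc u (es ! j)) * (\<epsilon> u' * inc u' (es ! j)))"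
      using ii by (simp add: B_def scalar_prod_def atLeast0LessThan u_def u'_def)
    also have "\<dots> = (\<Sum>v\<in>I. (\<epsilon> u * inc u v) * (\<epsilon> u' * inc u' v))"
      unfolding m_def es(2)[symmetric] by (rule sum_nth_distinct[OF es(1)])
    also have "\<dots> = laplacian_matrix G vs $$ (i, i')"
    proof (cases "i = i'")
      case True
      then have uu: "u' = u" by (simp add: u_def u'_def)
      have "(\<Sum>v\<in>I. (\<epsilon> u * inc u v) * (\<epsilon> u' * inc u' v)) = (\<Sum>v\<in>I. of_bool (u \<in> {v, par v}))"
      proof (rule sum.cong)
        fix v assume "v \<in> I"
        then have "inc u v * inc u v = of_bool (u \<in> {v, par v})"
          using par_ne[of v] by (auto simp: inc_def)
        moreover have "(\<epsilon> u * inc u v) * (\<epsilon> u' * inc u' v) = (\<epsilon> u * \<epsilon> u) * (inc u v * inc u v)"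
          by (simp add: uu mult_ac)
        ultimately show "(\<epsilon> u * inc u v) * (\<epsilon> u' * inc u' v) = of_bool (u \<in> {v, par v})"
          by (simp add: eps)
      qed simp
      also have "\<dots> = real (card {v \<in> I. u \<in> {v, par v}})"
        by (rule card_sum)
      \<comment> \<open>Distinct lower ends name distinct edges, so counting lower ends counts the
        edges at \<open>u\<close>.\<close>
      also have "card {v \<in> I. u \<in> {v, par v}} = card ((\<lambda>v. {v, par v}) ` {v \<in> I. u \<in> {v, par v}})"
        by (rule card_image[symmetric]) (rule inj_on_subset[OF E(2)], auto)
      also have "(\<lambda>v. {v, par v}) ` {v \<in> I. u \<in> {v, par v}} = {e \<in> snd G. u \<in> e}"
        unfolding E(1) by auto
      finally have "(\<Sum>v\<in>I. (\<epsilon> u * inc u v) * (\<epsilon> u' * inc u' v)) = real (vertex_degree G u)"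
        by (simp add: vertex_degree_def)
      moreover have "{u, u} \<notin> snd G" unfolding E(1) using par_ne by auto
      ultimately show ?thesis
        using ii True n uu
        by (simp add: laplacian_matrix_def degree_matrix_def adjacency_matrix_def u_def)
    next
      case False
      then have ne: "u \<noteq> u'" using vs(1) n ii by (simp add: u_def u'_def nth_eq_iff_index_eq)
      \<comment> \<open>Only an edge joining \<open>u\<close> and \<open>u'\<close> contributes, and
        its ends carry opposite signs.\<close>
      have "(\<Sum>v\<in>I. (\<epsilon> u * inc u v) * (\<epsilon> u' * inc u' v)) = (\<Sum>v\<in>I. - of_bool ({u, u'} = {v, par v}))"
      proof (rule sum.cong)
        fix v assume v: "v \<in> I"
        show "(\<epsilon> u * inc u v) * (\<epsilon> u' * inc u' v) = - of_bool ({u, u'} = {v, par v})"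
          using par_ne[OF v] eps(1)[of v] eps(2)[OF v] ne
          by (auto simp: inc_def doubleton_eq_iff)
      qed simp
      also have "\<dots> = - real (card {v \<in> I. {u, u'} = {v, par v}})"
        using \<open>finite I\<close> by (simp only: sum_negf card_sum)
      also have "card {v \<in> I. {u, u'} = {v, par v}} = of_bool ({u, u'} \<in> snd G)"
      proof (cases "{u, u'} \<in> snd G")
        case True
        then obtain v where v: "v \<in> I" "{u, u'} = {v, par v}" unfolding E(1) by auto
        then have "{v \<in> I. {u, u'} = {v, par v}} = {v}" using E(2) by (auto dest!: inj_onD)
        then show ?thesis using True by simp
      next
        case False
        then have none: "{v \<in> I. {u, u'} = {v, par v}} = {}" unfolding E(1) by auto
        show ?thesis unfolding none using False by simp
      qed
      finally show ?thesis
        using ii False n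
        by (simp add: laplacian_matrix_def degree_matrix_def adjacency_matrix_def u_def u'_def)
    qed
    finally show "laplacian_matrix G vs $$ (i, i') = (B * B\<^sup>T) $$ (i, i')" by simp
  qed (simp_all add: laplacian_matrix_def degree_matrix_def adjacency_matrix_def n B_def)
  have mu: "\<mu> = sorted_eigenvalues (B * B\<^sup>T) ! 1"
    unfolding \<mu>_def algebraic_connectivity_def vs_def[symmetric] L ..
  have norm: "y \<bullet> y = (\<Sum>v\<in>I. (x v)\<^sup>2)" and Bnorm: "(B *\<^sub>v y) \<bullet> (B *\<^sub>v y) = edge_form (fst G) I par x"
    if y: "y \<in> carrier_vec m" "\<And>j. j < m \<Longrightarrow> y $ j = x (es ! j)" for x y
  proof -
    have "y \<bullet> y = (\<Sum>j<length es. (x (es ! j))\<^sup>2)"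
      using y by (simp add: scalar_prod_def m_def atLeast0LessThan power2_eq_square)
    then show "y \<bullet> y = (\<Sum>v\<in>I. (x v)\<^sup>2)" using sum_nth_distinct[OF es(1)] es by simp
    have By: "(B *\<^sub>v y) $ i = \<epsilon> (vs ! i) * (\<Sum>v\<in>I. inc (vs ! i) v * x v)" if "i < Suc m" for i
    proof -
      have "(B *\<^sub>v y) $ i = (\<Sum>j<length es. \<epsilon> (vs ! i) * (inc (vs ! i) (es ! j) * x (es ! j)))"
        using y that by (simp add: scalar_prod_def m_def[symmetric] atLeast0LessThan B_def mult_ac)
      also have "\<dots> = (\<Sum>v\<in>I. \<epsilon> (vs ! i) * (inc (vs ! i) v * x v))"
        using sum_nth_distinct[OF es(1)] es by simp
      finally show ?thesis by (simp add: sum_distrib_left)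
    qed
    have "(B *\<^sub>v y) \<bullet> (B *\<^sub>v y) = (\<Sum>i<Suc m. (B *\<^sub>v y) $ i * (B *\<^sub>v y) $ i)"
      using B by (simp add: scalar_prod_def atLeast0LessThan)
    also have "\<dots> = (\<Sum>i<length vs. (\<Sum>v\<in>I. inc (vs ! i) v * x v)\<^sup>2)"
      unfolding n
    proof (rule sum.cong)
      fix i assume "i \<in> {..<Suc m}"
      then have "(B *\<^sub>v y) $ i * (B *\<^sub>v y) $ i
          = (\<epsilon> (vs ! i) * \<epsilon> (vs ! i)) * (\<Sum>v\<in>I. inc (vs ! i) v * x v)\<^sup>2"
        by (subst (1 2) By) (auto simp: power2_eq_square)
      then show "(B *\<^sub>v y) $ i * (B *\<^sub>v y) $ i = (\<Sum>v\<in>I. inc (vs ! i) v * x v)\<^sup>2"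
        by (simp add: eps)
    qed simp
    also have "\<dots> = edge_form (fst G) I par x"
      unfolding edge_form_def inc_def[symmetric] vs(2)[symmetric] by (rule sum_nth_distinct[OF vs(1)])
    finally show "(B *\<^sub>v y) \<bullet> (B *\<^sub>v y) = edge_form (fst G) I par x" .
  qed
  show "\<mu> * (\<Sum>v\<in>I. (x v)\<^sup>2) \<le> edge_form (fst G) I par x" for x
    using sorted_eigenvalues_gram_second(1)[OF B m, of "vec m (\<lambda>j. x (es ! j))"]
      norm[of "vec m (\<lambda>j. x (es ! j))" x] Bnorm[of "vec m (\<lambda>j. x (es ! j))" x]
    unfolding mu by simp
  obtain y where y: "y \<in> carrier_vec m" "y \<noteq> 0\<^sub>v m" "(B *\<^sub>v y) \<bullet> (B *\<^sub>v y) = \<mu> * (y \<bullet> y)"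
    using sorted_eigenvalues_gram_second(2)[OF B m] unfolding mu by blast
  \<comment> \<open>\<open>the_inv_into\<close> recovers the position of an edge in the list
    \<open>es\<close>.\<close>
  define x where "x v = y $ the_inv_into {..<m} ((!) es) v" for v
  have x: "y $ j = x (es ! j)" if "j < m" for j
    unfolding x_def using that es m_def
    by (subst the_inv_into_f_f) (auto simp: inj_on_def nth_eq_iff_index_eq)
  obtain j where "j < m" "y $ j \<noteq> 0"
    using y by (metis carrier_vecD eq_vecI index_zero_vec)
  then have "\<exists>v\<in>I. x v \<noteq> 0" using x es m_def by (metis nth_mem)
  then show "\<exists>x. (\<exists>v\<in>I. x v \<noteq> 0) \<and> edge_form (fst G) I par x = \<mu> * (\<Sum>v\<in>I. (x v)\<^sup>2)"
    using norm[OF y(1) x] Bnorm[OF y(1) x] y(3) by auto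
qed

section \<open>The caterpillar rooted at its first spine vertex\<close>

fun caterpillar_parent :: "caterpillar_vertex \<Rightarrow> caterpillar_vertex" where
  "caterpillar_parent (Spine i) = Spine (i - 1)"
| "caterpillar_parent (Pendant i j) = Spine i"

text \<open>The proper 2-colouring of the tree, with values 1 and -1.\<close>

fun caterpillar_sign :: "caterpillar_vertex \<Rightarrow> real" where
  "caterpillar_sign (Spine i) = (- 1) ^ i"
| "caterpillar_sign (Pendant i j) = (- 1) ^ Suc i"

definition pendants :: "nat \<Rightarrow> (nat \<Rightarrow> nat) \<Rightarrow> caterpillar_vertex set" where
  "pendants k q = (\<lambda>(i, j). Pendant i j) ` (SIGMA i:{1..k}. {1..q i})"

lemma sum_spine_pendants:
  assumes "finite A"
  shows "sum f (Spine ` A \<union> pendants k q)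
    = (\<Sum>i\<in>A. f (Spine i)) + (\<Sum>i=1..k. \<Sum>j=1..q i. (f (Pendant i j) :: real))"
proof -
  have "sum f (Spine ` A \<union> pendants k q) = sum f (Spine ` A) + sum f (pendants k q)"
    using assms by (intro sum.union_disjoint) (auto simp: pendants_def)
  moreover have "sum f (Spine ` A) = (\<Sum>i\<in>A. f (Spine i))"
    by (simp add: sum.reindex inj_on_def)
  moreover have "sum f (pendants k q) = (\<Sum>i=1..k. \<Sum>j=1..q i. f (Pendant i j))"
    unfolding pendants_def
    by (subst sum.reindex) (auto simp: inj_on_def sum.Sigma split_def)
  ultimately show ?thesis by simp
qed

text \<open>\<open>x (Spine i)\<close> is the weight of the edge from \<open>Spine i\<close> back to
  its predecessor, so the spine edges at vertex \<open>i\<close> carry the indices \<open>i\<close>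
  and \<open>Suc i\<close>; the conditionals drop the missing edge at either end of the path. A
  pendant vertex meets only its own edge, which gives the second sum.\<close>

lemma edge_form_caterpillar:
  assumes k: "k \<ge> 2"
  shows "edge_form (Spine ` {1..k} \<union> pendants k q) (Spine ` {2..k} \<union> pendants k q) caterpillar_parent x
    = (\<Sum>i=1..k. ((if i = 1 then 0 else x (Spine i)) + (if i = k then 0 else x (Spine (Suc i)))
         + (\<Sum>j=1..q i. x (Pendant i j)))\<^sup>2)
      + (\<Sum>i=1..k. \<Sum>j=1..q i. (x (Pendant i j))\<^sup>2)"
proof -
  define g where "g u v = (of_bool (u = v) + of_bool (u = caterpillar_parent v)) * x v" for u v
  let ?I = "Spine ` {2..k} \<union> pendants k q"
  have S: "sum (g (Spine i)) ?I
      = (if i = 1 then 0 else x (Spine i)) + (if i = k then 0 else x (Spine (Suc i))) + (\<Sum>j=1..q i. x (Pendant i j))"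
    if i: "i \<in> {1..k}" for i
  proof -
    have "(\<Sum>a=2..k. g (Spine i) (Spine a))
        = (\<Sum>a=2..k. (if a = i then x (Spine i) else 0)) + (\<Sum>a=2..k. (if a = Suc i then x (Spine (Suc i)) else 0))"
      unfolding sum.distrib[symmetric] using i by (intro sum.cong) (auto simp: g_def)
    also have "\<dots> = (if i = 1 then 0 else x (Spine i)) + (if i = k then 0 else x (Spine (Suc i)))"
      using i by (simp only: sum.delta[OF finite_atLeastAtMost]) auto
    finally have 1: "(\<Sum>a=2..k. g (Spine i) (Spine a)) = \<dots>" .
    have "(\<Sum>a=1..k. \<Sum>j=1..q a. g (Spine i) (Pendant a j))
        = (\<Sum>a=1..k. if a = i then (\<Sum>j=1..q i. x (Pendant i j)) else 0)"
      by (intro sum.cong) (auto simp: g_def)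
    also have "\<dots> = (\<Sum>j=1..q i. x (Pendant i j))"
      using i by (simp only: sum.delta[OF finite_atLeastAtMost]) auto
    finally show ?thesis using 1 by (simp add: sum_spine_pendants)
  qed
  have P: "sum (g (Pendant i j)) ?I = x (Pendant i j)" if i: "i \<in> {1..k}" and j: "j \<in> {1..q i}" for i j
  proof -
    have "Pendant i j \<noteq> caterpillar_parent v" for v
      by (cases v) auto
    then have "sum (g (Pendant i j)) ?I = (\<Sum>v\<in>?I. if v = Pendant i j then x v else 0)"
      by (intro sum.cong) (auto simp: g_def)
    also have "\<dots> = x (Pendant i j)"
      using i j by (subst sum.delta) (force simp: pendants_def)+
    finally show ?thesis .
  qed
  have "edge_form (Spine ` {1..k} \<union> pendants k q) ?I caterpillar_parent x
      = (\<Sum>i=1..k. (sum (g (Spine i)) ?I)\<^sup>2) + (\<Sum>i=1..k. \<Sum>j=1..q i. (sum (g (Pendant i j)) ?I)\<^sup>2)"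
    unfolding edge_form_def g_def[symmetric] by (subst sum_spine_pendants) auto
  also have "(\<Sum>i=1..k. (sum (g (Spine i)) ?I)\<^sup>2)
      = (\<Sum>i=1..k. ((if i = 1 then 0 else x (Spine i)) + (if i = k then 0 else x (Spine (Suc i)))
         + (\<Sum>j=1..q i. x (Pendant i j)))\<^sup>2)"
    by (intro sum.cong refl) (simp only: S)
  also have "(\<Sum>i=1..k. \<Sum>j=1..q i. (sum (g (Pendant i j)) ?I)\<^sup>2) = (\<Sum>i=1..k. \<Sum>j=1..q i. (x (Pendant i j))\<^sup>2)"
    by (intro sum.cong refl) (simp only: P)
  finally show ?thesis .
qed

lemma caterpillar_connectivity:
  fixes q :: "nat \<Rightarrow> nat"
  assumes k: "k \<ge> 2"
  defines "\<mu> \<equiv> algebraic_connectivity (caterpillar k q)"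
    and "I \<equiv> Spine ` {2..k} \<union> pendants k q"
    and "V \<equiv> Spine ` {1..k} \<union> pendants k q"
  shows "\<And>x. \<mu> * (\<Sum>v\<in>I. (x v)\<^sup>2) \<le> edge_form V I caterpillar_parent x"
    and "\<exists>x. (\<exists>v\<in>I. x v \<noteq> 0) \<and> edge_form V I caterpillar_parent x = \<mu> * (\<Sum>v\<in>I. (x v)\<^sup>2)"
proof -
  have V: "fst (caterpillar k q) = V"
    unfolding caterpillar_def V_def pendants_def by auto
  have finV: "finite V" by (auto simp: V_def pendants_def)
  have root: "Spine 1 \<in> V" using k by (simp add: V_def)
  have I: "I = V - {Spine 1}" by (auto simp: I_def V_def pendants_def)
  have Ine: "I \<noteq> {}" using k by (auto simp: I_def)
  have spE: "{{Spine i, Spine (i + 1)} | i. i \<in> {1..k - 1}} = (\<lambda>v. {v, caterpillar_parent v}) ` Spine ` {2..k}"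
  proof -
    \<comment> \<open>The graph indexes spine edges by the end nearer the root, \<open>I\<close> by
      the farther end.\<close>
    have "{2..k} = Suc ` {1..k - 1}" using k by (simp add: image_Suc_atLeastAtMost numeral_2_eq_2)
    then have "(\<lambda>v. {v, caterpillar_parent v}) ` Spine ` {2..k} = (\<lambda>i. {Spine i, Spine (i + 1)}) ` {1..k - 1}"
      by (simp add: image_image insert_commute del: image_Suc_atLeastAtMost)
    then show ?thesis by auto
  qed
  have pdE: "{{Spine i, Pendant i j} | i j. i \<in> {1..k} \<and> j \<in> {1..q i}} = (\<lambda>v. {v, caterpillar_parent v}) ` pendants k q"
  proof -
    have "{f i j | i j. i \<in> A \<and> j \<in> B i} = (\<lambda>(i, j). f i j) ` (SIGMA i:A. B i)"
      for f :: "nat \<Rightarrow> nat \<Rightarrow> caterpillar_vertex set" and A B by auto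
    then have "{{Spine i, Pendant i j} | i j. i \<in> {1..k} \<and> j \<in> {1..q i}}
        = (\<lambda>(i, j). {Spine i, Pendant i j}) ` (SIGMA i:{1..k}. {1..q i})" .
    also have "\<dots> = (\<lambda>v. {v, caterpillar_parent v}) ` pendants k q"
      unfolding pendants_def image_image by (intro image_cong) auto
    finally show ?thesis .
  qed
  have E: "snd (caterpillar k q) = (\<lambda>v. {v, caterpillar_parent v}) ` I"
    unfolding caterpillar_def I_def image_Un snd_conv spE pdE ..
  have inj: "inj_on (\<lambda>v. {v, caterpillar_parent v}) I"
    unfolding inj_on_def I_def pendants_def by (auto simp: doubleton_eq_iff)
  have eps1: "caterpillar_sign v * caterpillar_sign v = 1" for v
    by (cases v) (auto simp flip: power_add simp: power_even_eq)
  have eps2: "caterpillar_sign (caterpillar_parent v) = - caterpillar_sign v" if v: "v \<in> I" for v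
  proof (cases v)
    case (Spine i)
    then have "i \<ge> 2" using v by (auto simp: I_def pendants_def)
    then show ?thesis using Spine by (cases i) auto
  qed auto
  note * = algebraic_connectivity_rooted_tree[of "caterpillar k q" "Spine 1" I caterpillar_parent caterpillar_sign,
      unfolded V, OF finV root I Ine E inj eps1 eps2, folded \<mu>_def]
  show "\<mu> * (\<Sum>v\<in>I. (x v)\<^sup>2) \<le> edge_form V I caterpillar_parent x" for x using *(1) .
  show "\<exists>x. (\<exists>v\<in>I. x v \<noteq> 0) \<and> edge_form V I caterpillar_parent x = \<mu> * (\<Sum>v\<in>I. (x v)\<^sup>2)" using *(2) .
qed

section \<open>The form of the matrix 2I + C\<close>

lemma C_entry_sym: "C_entry q r s = C_entry q s r"
  by (auto simp: C_entry_def)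

lemma sum_square_extend:
  fixes h :: "nat \<Rightarrow> nat \<Rightarrow> real"
  assumes "\<And>r s. h r s = h s r"
  shows "(\<Sum>r<Suc n. \<Sum>s<Suc n. h r s) = (\<Sum>r<n. \<Sum>s<n. h r s) + 2 * (\<Sum>s<n. h n s) + h n n"
proof -
  have "(\<Sum>r<n. h r n) = (\<Sum>s<n. h n s)" using assms by simp
  then show ?thesis by (simp add: sum.distrib)
qed

text \<open>Positions of \<open>z\<close> start at 0: the coordinates of the spine edges \<open>u\<^sub>i\<^sub>-\<^sub>1 u\<^sub>i\<close> and \<open>u\<^sub>i u\<^sub>i\<^sub>+\<^sub>1\<close> are
  \<open>2 i - 3\<close> and \<open>2 i - 1\<close>, that of the pendant edges at \<open>u\<^sub>i\<close> is \<open>2 i - 2\<close>.\<close>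

definition spine_term :: "nat \<Rightarrow> (nat \<Rightarrow> nat) \<Rightarrow> (nat \<Rightarrow> real) \<Rightarrow> nat \<Rightarrow> real" where
  "spine_term k q z i = (if i = 1 then 0 else z (2 * i - 3)) + (if i = k then 0 else z (2 * i - 1))
     + sqrt (real (q i)) * z (2 * i - 2)"

text \<open>The part of the diagonal entry \<open>2 + max 0 (q - 1)\<close> left after
  \<open>q\<close> is spent on the square of a \<open>spine_term\<close>. The maximum causes the
  exception at 0.\<close>

definition leaf_weight :: "nat \<Rightarrow> real" where
  "leaf_weight n = (if n = 0 then 2 else 1)"

text \<open>Induction along the spine, two coordinates at a time. The square of the last vertex
  stays open, without its outgoing spine edge; the next edge completes it and starts the square of
  the following vertex.\<close>

lemma C_form_sum_squares:
  fixes z :: "nat \<Rightarrow> real"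
  assumes k: "k \<ge> 1"
  shows "(\<Sum>r<2 * k - 1. \<Sum>s<2 * k - 1. (2 * of_bool (r = s) + C_entry q (r + 1) (s + 1)) * z r * z s)
    = (\<Sum>i=1..k. (spine_term k q z i)\<^sup>2) + (\<Sum>i=1..k. leaf_weight (q i) * (z (2 * i - 2))\<^sup>2)"
proof -
  define h where "h r s = (2 * of_bool (r = s) + C_entry q (r + 1) (s + 1)) * z r * z s" for r s
  have hsym: "h r s = h s r" for r s
    unfolding h_def using C_entry_sym[of q "r + 1" "s + 1"] by (auto simp: mult_ac)
  \<comment> \<open>Spine vertices are counted from 0 here: \<open>prev n\<close> is the weight of
    the edge entering vertex \<open>n\<close>, and \<open>T\<close> is a completed square.\<close>
  define prev where "prev n = (if n = 0 then 0 else z (2 * n - 1))" for n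
  define T where "T i = (prev i + z (2 * i + 1) + sqrt (real (q (Suc i))) * z (2 * i))\<^sup>2" for i
  define c where "c i = leaf_weight (q (Suc i)) * (z (2 * i))\<^sup>2" for i
  have diag: "leaf_weight (q i) + real (q i) = 2 + max 0 (real (q i) - 1)" for i
    by (auto simp: leaf_weight_def)
  have "(\<Sum>r<2 * n + 1. \<Sum>s<2 * n + 1. h r s)
      = (\<Sum>i<n. T i) + (prev n + sqrt (real (q (Suc n))) * z (2 * n))\<^sup>2 + (\<Sum>i<Suc n. c i)" for n
  proof (induction n)
    case 0
    have "h 0 0 = (leaf_weight (q 1) + real (q 1)) * z 0 * z 0"
      unfolding diag by (simp add: h_def C_entry_def)
    then show ?case by (simp add: prev_def c_def power2_eq_square algebra_simps)
  next
    case (Suc n)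
    \<comment> \<open>Left of the diagonal this row is nonzero only in columns
      \<open>2 * n - 1\<close> and \<open>2 * n\<close> at most, and the row of \<open>row2\<close>
      only in column \<open>2 * n + 1\<close>.\<close>
    have row1: "(\<Sum>s<2 * n + 1. h (2 * n + 1) s) = z (2 * n + 1) * (prev n + sqrt (real (q (Suc n))) * z (2 * n))"
    proof (cases n)
      case 0 then show ?thesis by (simp add: h_def C_entry_def prev_def)
    next
      case (Suc m)
      have "(\<Sum>s<2 * m + 1. h (2 * n + 1) s) = 0"
        by (rule sum.neutral) (auto simp: h_def C_entry_def Suc)
      moreover have "2 * n + 1 = Suc (Suc (2 * m + 1))" using Suc by simp
      ultimately have "(\<Sum>s<2 * n + 1. h (2 * n + 1) s) = h (2 * n + 1) (2 * m + 1) + h (2 * n + 1) (2 * m + 2)"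
        by simp
      then show ?thesis by (simp add: h_def C_entry_def prev_def Suc algebra_simps)
    qed
    have row2: "(\<Sum>s<2 * n + 2. h (2 * n + 2) s) = z (2 * n + 2) * (sqrt (real (q (Suc (Suc n)))) * z (2 * n + 1))"
    proof -
      have "(\<Sum>s<2 * n + 1. h (2 * n + 2) s) = 0"
        by (rule sum.neutral) (auto simp: h_def C_entry_def)
      then have "(\<Sum>s<2 * n + 2. h (2 * n + 2) s) = h (2 * n + 2) (2 * n + 1)" by simp
      then show ?thesis by (simp add: h_def C_entry_def)
    qed
    have d1: "h (2 * n + 1) (2 * n + 1) = 2 * (z (2 * n + 1))\<^sup>2"
      by (simp add: h_def C_entry_def power2_eq_square)
    have d2: "h (2 * n + 2) (2 * n + 2) = (leaf_weight (q (Suc (Suc n))) + real (q (Suc (Suc n)))) * (z (2 * n + 2))\<^sup>2"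
      unfolding diag by (simp add: h_def C_entry_def power2_eq_square)
    have "(\<Sum>r<2 * Suc n + 1. \<Sum>s<2 * Suc n + 1. h r s)
        = (\<Sum>r<2 * n + 1. \<Sum>s<2 * n + 1. h r s) + 2 * (\<Sum>s<2 * n + 1. h (2 * n + 1) s) + h (2 * n + 1) (2 * n + 1)
          + 2 * (\<Sum>s<2 * n + 2. h (2 * n + 2) s) + h (2 * n + 2) (2 * n + 2)"
      using sum_square_extend[of h "2 * n + 1", OF hsym] sum_square_extend[of h "2 * n + 2", OF hsym]
      by simp
    also have "\<dots> = (\<Sum>i<Suc n. T i) + (prev (Suc n) + sqrt (real (q (Suc (Suc n)))) * z (2 * Suc n))\<^sup>2 + (\<Sum>i<Suc (Suc n). c i)"
    proof -
      \<comment> \<open>Here \<open>s\<close> is the new spine edge and \<open>a\<close> the new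
        pendant coordinate; the diagonal 2 supplies one square of \<open>s\<close> for each end of
        the edge.\<close>
      have *: "X + Y\<^sup>2 + Z + 2 * (s * Y) + 2 * s\<^sup>2 + 2 * (a * (g * s)) + (l + g\<^sup>2) * a\<^sup>2
          = X + (s + Y)\<^sup>2 + (s + g * a)\<^sup>2 + (Z + l * a\<^sup>2)" for X Y Z s a g l :: real
        by (simp add: power2_eq_square algebra_simps)
      have g2: "real (q (Suc (Suc n))) = (sqrt (real (q (Suc (Suc n)))))\<^sup>2" by simp
      show ?thesis
        unfolding Suc.IH row1 row2 d1 d2
        by (subst (2) g2, subst *) (simp add: T_def c_def prev_def algebra_simps)
    qed
    finally show ?case .
  qed
  moreover have "2 * (k - 1) + 1 = 2 * k - 1" "2 * (k - 1) = 2 * k - 2" "Suc (k - 1) = k"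
    using k by auto
  ultimately have "(\<Sum>r<2 * k - 1. \<Sum>s<2 * k - 1. h r s)
      = (\<Sum>i<k - 1. T i) + (prev (k - 1) + sqrt (real (q k)) * z (2 * k - 2))\<^sup>2 + (\<Sum>i<k. c i)"
    by metis
  moreover have "(\<Sum>i=1..k. (spine_term k q z i)\<^sup>2)
      = (\<Sum>i<k - 1. T i) + (prev (k - 1) + sqrt (real (q k)) * z (2 * k - 2))\<^sup>2"
  proof -
    obtain n where n: "k = Suc n" using k by (cases k) auto
    have "(\<Sum>i=1..k. (spine_term k q z i)\<^sup>2) = (\<Sum>i<n. (spine_term k q z (Suc i))\<^sup>2) + (spine_term k q z k)\<^sup>2"
      by (simp add: n sum.atLeast1_atMost_eq)
    moreover have "spine_term k q z k = prev (k - 1) + sqrt (real (q k)) * z (2 * k - 2)"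
      by (simp add: spine_term_def prev_def n numeral_eq_Suc)
    moreover have "(\<Sum>i<n. (spine_term k q z (Suc i))\<^sup>2) = (\<Sum>i<n. T i)"
      by (intro sum.cong refl) (simp add: spine_term_def T_def prev_def n numeral_eq_Suc)
    ultimately show ?thesis by (simp add: n)
  qed
  moreover have "(\<Sum>i=1..k. leaf_weight (q i) * (z (2 * i - 2))\<^sup>2) = (\<Sum>i<k. c i)"
    by (simp add: sum.atLeast1_atMost_eq c_def)
  ultimately show ?thesis by (simp add: h_def)
qed

lemma sum_even_odd_positions:
  fixes f :: "nat \<Rightarrow> real"
  assumes "k \<ge> 1"
  shows "(\<Sum>r<2 * k - 1. f r) = (\<Sum>i=2..k. f (2 * i - 3)) + (\<Sum>i=1..k. f (2 * i - 2))"
proof -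
  have "(\<Sum>r<2 * n + 1. f r) = (\<Sum>i=2..Suc n. f (2 * i - 3)) + (\<Sum>i=1..Suc n. f (2 * i - 2))" for n
    by (induction n) (simp_all add: numeral_eq_Suc)
  moreover have "2 * (k - 1) + 1 = 2 * k - 1" "Suc (k - 1) = k" using assms by auto
  ultimately show ?thesis by metis
qed

locale caterpillar_bounds =
  fixes k b :: nat and q :: "nat \<Rightarrow> nat"
  assumes k: "k \<ge> 2" and b: "b = 2 * k - 1"
begin

definition "M = 2 \<cdot>\<^sub>m 1\<^sub>m b + C_matrix k q"

definition "\<mu> = algebraic_connectivity (caterpillar k q)"

lemma M_carrier: "M \<in> carrier_mat b b"
  unfolding M_def C_matrix_def b[symmetric] by simp

lemma M_entry: "r < b \<Longrightarrow> s < b \<Longrightarrow> M $$ (r, s) = 2 * of_bool (r = s) + C_entry q (r + 1) (s + 1)"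
  unfolding M_def C_matrix_def b[symmetric] by simp

lemma M_sym: "M\<^sup>T = M"
  using M_carrier by (intro eq_matI) (auto simp: M_entry C_entry_sym)

lemma M_form:
  assumes "z \<in> carrier_vec b"
  shows "z \<bullet> (M *\<^sub>v z) = (\<Sum>i=1..k. (spine_term k q (($) z) i)\<^sup>2) + (\<Sum>i=1..k. leaf_weight (q i) * (z $ (2 * i - 2))\<^sup>2)"
proof -
  have "z \<bullet> (M *\<^sub>v z) = (\<Sum>r<b. \<Sum>s<b. (2 * of_bool (r = s) + C_entry q (r + 1) (s + 1)) * z $ r * z $ s)"
    unfolding form_eq_double_sum[OF M_carrier assms] by (intro sum.cong refl) (simp add: M_entry)
  then show ?thesis using C_form_sum_squares[of k q "($) z"] k by (simp add: b)
qed

lemma norm_split: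
  fixes z :: "real vec"
  assumes "z \<in> carrier_vec b"
  shows "z \<bullet> z = (\<Sum>i=2..k. (z $ (2 * i - 3))\<^sup>2) + (\<Sum>i=1..k. (z $ (2 * i - 2))\<^sup>2)"
proof -
  have "z \<bullet> z = (\<Sum>r<b. (z $ r)\<^sup>2)"
    using assms by (simp add: scalar_prod_def power2_eq_square atLeast0LessThan)
  then show ?thesis using sum_even_odd_positions[of k "\<lambda>r. (z $ r)\<^sup>2"] k by (simp add: b)
qed

lemma M_psd: "z \<in> carrier_vec b \<Longrightarrow> 0 \<le> z \<bullet> (M *\<^sub>v z)"
  unfolding M_form by (intro add_nonneg_nonneg sum_nonneg) (auto simp: leaf_weight_def)

text \<open>All squares in the form must vanish. The positive leaf weights kill the pendant
  coordinates, and then the spine terms kill the spine edges one after another from the first vertex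
  on.\<close>

lemma M_inj:
  assumes z: "z \<in> carrier_vec b" and Mz: "M *\<^sub>v z = 0\<^sub>v b"
  shows "z = 0\<^sub>v b"
proof -
  define A where "A = (\<Sum>i=1..k. (spine_term k q (($) z) i)\<^sup>2)"
  define B where "B = (\<Sum>i=1..k. leaf_weight (q i) * (z $ (2 * i - 2))\<^sup>2)"
  have "A + B = 0" using M_form[OF z] Mz z unfolding A_def B_def by simp
  moreover have "A \<ge> 0" "B \<ge> 0"
    unfolding A_def B_def by (auto simp: leaf_weight_def intro!: sum_nonneg)
  ultimately have "A = 0" "B = 0" by auto
  have even0: "z $ (2 * i - 2) = 0" if "i \<in> {1..k}" for i
  proof -
    have "\<forall>i\<in>{1..k}. leaf_weight (q i) * (z $ (2 * i - 2))\<^sup>2 = 0"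
      using \<open>B = 0\<close> unfolding B_def
      by (subst (asm) sum_nonneg_eq_0_iff) (auto simp: leaf_weight_def)
    then show ?thesis using that by (auto simp: leaf_weight_def split: if_splits)
  qed
  have sp: "spine_term k q (($) z) i = 0" if "i \<in> {1..k}" for i
  proof -
    have "\<forall>i\<in>{1..k}. (spine_term k q (($) z) i)\<^sup>2 = 0"
      using \<open>A = 0\<close> unfolding A_def by (subst (asm) sum_nonneg_eq_0_iff) auto
    then show ?thesis using that by auto
  qed
  have odd0: "i < k \<longrightarrow> z $ (2 * i - 1) = 0" if "i \<ge> 1" for i
    using that
  proof (induction i rule: nat_induct_at_least)
    case base
    then show ?case using sp[of 1] even0[of 1] by (auto simp: spine_term_def)
  next
    case (Suc i)
    have "2 * Suc i - 3 = 2 * i - 1" using Suc by simp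
    then show ?case using sp[of "Suc i"] even0[of "Suc i"] Suc by (auto simp: spine_term_def)
  qed
  show ?thesis
  proof (rule eq_vecI)
    fix r assume "r < dim_vec (0\<^sub>v b :: real vec)"
    then have r: "r < b" by simp
    have "z $ r = 0"
    proof (cases "even r")
      case True
      then obtain m where "r = 2 * m" by auto
      then show ?thesis using even0[of "Suc m"] r by (simp add: b)
    next
      case False
      then obtain m where "r = 2 * m + 1" by (metis oddE)
      then show ?thesis using odd0[of "Suc m"] r by (simp add: b)
    qed
    then show "z $ r = 0\<^sub>v b $ r" using r by simp
  qed (use z in simp)
qed

section \<open>Comparison of the two Rayleigh quotients\<close>

text \<open>The test weight is 1 on the first spine edge and 0 elsewhere: it has norm 1, and each of
  its two ends contributes 1 to the edge form.\<close>

lemma connectivity_le_2: "\<mu> \<le> 2"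
proof -
  define x :: "caterpillar_vertex \<Rightarrow> real" where "x v = of_bool (v = Spine 2)" for v
  have "(\<Sum>i=1..k. ((if i = 1 then 0 else x (Spine i)) + (if i = k then 0 else x (Spine (Suc i))))\<^sup>2)
      = (\<Sum>i=1..k. (if i = 2 then 1 else 0) + (if i = 1 then 1 else 0))"
    using k by (intro sum.cong) (auto simp: x_def)
  also have "\<dots> = 2" using k by (simp add: sum.distrib)
  finally have "edge_form (Spine ` {1..k} \<union> pendants k q) (Spine ` {2..k} \<union> pendants k q) caterpillar_parent x = 2"
    unfolding edge_form_caterpillar[OF k] by (simp add: x_def)
  moreover have "(\<Sum>v\<in>Spine ` {2..k} \<union> pendants k q. (x v)\<^sup>2) = 1"
  proof -
    have "(\<Sum>i=2..k. (x (Spine i))\<^sup>2) = (\<Sum>i=2..k. if i = 2 then 1 else 0)"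
      by (intro sum.cong) (auto simp: x_def)
    then show ?thesis using k by (simp add: sum_spine_pendants) (simp add: x_def)
  qed
  ultimately show ?thesis
    using caterpillar_connectivity(1)[OF k, of q x] by (simp add: \<mu>_def)
qed

text \<open>A vector \<open>z\<close> corresponds to the edge weights that take its values on the spine
  edges, and the value at \<open>u\<^sub>i\<close> divided by \<open>sqrt q\<^sub>i\<close> on each pendant edge at \<open>u\<^sub>i\<close>. A coordinate with
  \<open>q\<^sub>i = 0\<close> corresponds to no edge, and is harmless because \<open>\<mu> \<le> 2\<close>.\<close>

lemma connectivity_le_form:
  assumes z: "z \<in> carrier_vec b"
  shows "\<mu> * (z \<bullet> z) \<le> z \<bullet> (M *\<^sub>v z)"
proof -
  define x where "x v = (case v of Spine i \<Rightarrow> z $ (2 * i - 3) | Pendant i j \<Rightarrow> z $ (2 * i - 2) / sqrt (real (q i)))" for v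
  \<comment> \<open>The mass on coordinates without an edge, where \<open>x\<close> has no value to
    carry. Passing to \<open>x\<close> lowers the squared norm by \<open>e\<close> and the form by
    \<open>2 * e\<close>.\<close>
  define e where "e = (\<Sum>i=1..k. of_bool (q i = 0) * (z $ (2 * i - 2))\<^sup>2)"
  have pend: "(\<Sum>j=1..q i. x (Pendant i j)) = sqrt (real (q i)) * z $ (2 * i - 2)" for i
  proof -
    have "(\<Sum>j=1..q i. x (Pendant i j)) = (real (q i) / sqrt (real (q i))) * z $ (2 * i - 2)"
      by (simp add: x_def)
    then show ?thesis by (simp only: real_div_sqrt[OF of_nat_0_le_iff])
  qed
  have pend2: "(\<Sum>i=1..k. \<Sum>j=1..q i. (x (Pendant i j))\<^sup>2) = (\<Sum>i=1..k. (z $ (2 * i - 2))\<^sup>2) - e"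
    unfolding e_def sum_subtractf[symmetric]
    by (intro sum.cong refl) (simp add: x_def power_divide)
  have norm: "(\<Sum>v\<in>Spine ` {2..k} \<union> pendants k q. (x v)\<^sup>2) = z \<bullet> z - e"
    unfolding norm_split[OF z] sum_spine_pendants[OF finite_atLeastAtMost] pend2
    by (simp add: x_def)
  have sp: "(if i = 1 then 0 else x (Spine i)) + (if i = k then 0 else x (Spine (Suc i))) + (\<Sum>j=1..q i. x (Pendant i j))
      = spine_term k q (($) z) i" for i
    unfolding spine_term_def pend by (simp add: x_def numeral_eq_Suc)
  have "edge_form (Spine ` {1..k} \<union> pendants k q) (Spine ` {2..k} \<union> pendants k q) caterpillar_parent x
      = z \<bullet> (M *\<^sub>v z) - 2 * e"
  proof -
    have "(\<Sum>i=1..k. (z $ (2 * i - 2))\<^sup>2) + e = (\<Sum>i=1..k. leaf_weight (q i) * (z $ (2 * i - 2))\<^sup>2)"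
      unfolding e_def sum.distrib[symmetric]
      by (intro sum.cong) (auto simp: leaf_weight_def)
    then show ?thesis unfolding edge_form_caterpillar[OF k] sp pend2 M_form[OF z] by simp
  qed
  then have "\<mu> * (z \<bullet> z - e) \<le> z \<bullet> (M *\<^sub>v z) - 2 * e"
    using caterpillar_connectivity(1)[OF k, of q x] norm by (simp add: \<mu>_def)
  moreover have "\<mu> * e \<le> 2 * e"
    using connectivity_le_2 by (intro mult_right_mono) (auto simp: e_def intro!: sum_nonneg)
  ultimately show ?thesis by (simp add: algebra_simps)
qed

text \<open>The vector \<open>t\<close> puts weight on the pendant coordinate at vertex
  \<open>i\<close> and on one incident spine edge so that they cancel at \<open>i\<close>. It serves
  to show \<open>\<mu> \<le> 1\<close> once a pendant vertex exists, and as a minimiser when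
  \<open>\<mu> = 1\<close>.\<close>

lemma unit_rayleigh_vector:
  assumes i: "i \<in> {1..k}" and qi: "q i \<ge> 1"
  obtains t where "t \<in> carrier_vec b" "t \<bullet> t > 0" "t \<bullet> (M *\<^sub>v t) = t \<bullet> t"
proof -
  \<comment> \<open>The spine edge leads forward, or backward from the last vertex.\<close>
  define p r where "p = 2 * i - 2" and "r = (if i < k then 2 * i - 1 else 2 * i - 3)"
  have pr: "p < b" "r < b" "p \<noteq> r" using i k by (auto simp: b p_def r_def)
  obtain n where n: "i = Suc n" using i by (cases i) auto
  have pp: "M $$ (p, p) = real (q i) + 1"
    using pr qi by (simp add: M_entry p_def n C_entry_def)
  have rr: "M $$ (r, r) = 2"
    using pr i k by (auto simp: M_entry r_def n C_entry_def)
  have mpr: "M $$ (p, r) = sqrt (real (q i))"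
    using pr i k by (auto simp: M_entry p_def r_def n C_entry_def)
  define t where "t = unit_vec b p + (- sqrt (real (q i))) \<cdot>\<^sub>v unit_vec b r"
  have "t \<in> carrier_vec b" by (simp add: t_def)
  moreover have "t \<bullet> (M *\<^sub>v t) = real (q i) + 1"
    unfolding t_def form_lincomb[OF M_carrier M_sym unit_vec_carrier unit_vec_carrier]
    using pr by (simp add: unit_vec_form[OF M_carrier] pp rr mpr)
  moreover have "t \<bullet> t = real (q i) + 1"
    using form_lincomb[OF one_carrier_mat transpose_one unit_vec_carrier unit_vec_carrier, of b p "- sqrt (real (q i))" r] pr
    by (simp add: t_def)
  ultimately show ?thesis using that[of t] by simp
qed

text \<open>Averaging a minimiser over the pendant edges at each spine vertex removes a part on which the
  edge form is the squared norm. If some \<open>q\<^sub>i \<ge> 1\<close> then \<open>\<mu> \<le> 1\<close>, so this does not increase the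
  Rayleigh quotient; if nothing is left, then \<open>\<mu> = 1\<close>.\<close>

lemma connectivity_attained:
  obtains t where "t \<in> carrier_vec b" "t \<bullet> t > 0" "t \<bullet> (M *\<^sub>v t) \<le> \<mu> * (t \<bullet> t)"
proof -
  let ?V = "Spine ` {1..k} \<union> pendants k q" and ?I = "Spine ` {2..k} \<union> pendants k q"
  obtain x v where v: "v \<in> ?I" "x v \<noteq> 0" and x: "edge_form ?V ?I caterpillar_parent x = \<mu> * (\<Sum>v\<in>?I. (x v)\<^sup>2)"
    using caterpillar_connectivity(2)[OF k, of q] unfolding \<mu>_def by blast
  have xpos: "(\<Sum>v\<in>?I. (x v)\<^sup>2) > 0"
    using v by (intro sum_pos2[of _ v]) (auto simp: pendants_def)
  define \<sigma> where "\<sigma> i = (\<Sum>j=1..q i. x (Pendant i j))" for i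
  define d where "d i = (\<Sum>j=1..q i. (x (Pendant i j) - \<sigma> i / real (q i))\<^sup>2)" for i
  \<comment> \<open>The even coordinate \<open>2 * i - 2\<close> holds \<open>sqrt (q i)\<close>
    times the mean pendant weight at vertex \<open>i\<close>, and 0 if
    \<open>q i = 0\<close>.\<close>
  define z where "z = vec b (\<lambda>r. if even r then \<sigma> (r div 2 + 1) / sqrt (real (q (r div 2 + 1))) else x (Spine ((r + 3) div 2)))"
  have z: "z \<in> carrier_vec b" by (simp add: z_def)
  have zs: "z $ (2 * i - 3) = x (Spine i)" if "2 \<le> i" "i \<le> k" for i
  proof -
    obtain n where "i = Suc (Suc n)" using \<open>2 \<le> i\<close> by (metis Suc_le_D numeral_2_eq_2 Suc_le_mono)
    then show ?thesis using that by (simp add: z_def b)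
  qed
  have za: "z $ (2 * i - 2) = \<sigma> i / sqrt (real (q i))" if "1 \<le> i" "i \<le> k" for i
  proof -
    obtain n where "i = Suc n" using \<open>1 \<le> i\<close> by (cases i) auto
    then show ?thesis using that by (simp add: z_def b)
  qed
  \<comment> \<open>Decomposition of a sum of squares into the contribution of the mean and the
    deviation from it.\<close>
  have d: "(\<Sum>j=1..q i. (x (Pendant i j))\<^sup>2) = (\<sigma> i / sqrt (real (q i)))\<^sup>2 + d i" for i
  proof (cases "q i = 0")
    case False
    have "(\<Sum>j=1..n. (f j - c)\<^sup>2) = (\<Sum>j=1..n. (f j)\<^sup>2) - 2 * c * sum f {1..n} + real n * c\<^sup>2"
      for f :: "nat \<Rightarrow> real" and c n
      by (simp add: power2_diff sum.distrib sum_subtractf sum_distrib_left mult_ac)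
    then have "d i = (\<Sum>j=1..q i. (x (Pendant i j))\<^sup>2) - 2 * (\<sigma> i / real (q i)) * \<sigma> i + real (q i) * (\<sigma> i / real (q i))\<^sup>2"
      unfolding d_def \<sigma>_def .
    then show ?thesis using False by (simp add: power_divide power2_eq_square field_simps)
  qed (simp add: d_def)
  define D where "D = (\<Sum>i=1..k. d i)"
  have pend2: "(\<Sum>i=1..k. \<Sum>j=1..q i. (x (Pendant i j))\<^sup>2) = (\<Sum>i=1..k. (z $ (2 * i - 2))\<^sup>2) + D"
    unfolding D_def sum.distrib[symmetric] by (intro sum.cong refl) (simp only: d, simp add: za)
  have lw: "(\<Sum>i=1..k. leaf_weight (q i) * (z $ (2 * i - 2))\<^sup>2) = (\<Sum>i=1..k. (z $ (2 * i - 2))\<^sup>2)"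
    by (intro sum.cong refl) (simp add: za leaf_weight_def)
  have norm: "(\<Sum>v\<in>?I. (x v)\<^sup>2) = z \<bullet> z + D"
    unfolding norm_split[OF z] sum_spine_pendants[OF finite_atLeastAtMost] pend2
    by (simp add: zs)
  have sp: "(if i = 1 then 0 else x (Spine i)) + (if i = k then 0 else x (Spine (Suc i))) + \<sigma> i
      = spine_term k q (($) z) i" if "i \<in> {1..k}" for i
  proof -
    have "\<sigma> i = sqrt (real (q i)) * (\<sigma> i / sqrt (real (q i)))" by (simp add: \<sigma>_def)
    moreover have "z $ (2 * i - 1) = x (Spine (Suc i))" if "i \<noteq> k"
      using zs[of "Suc i"] \<open>i \<in> {1..k}\<close> that by (simp add: numeral_eq_Suc)
    ultimately show ?thesis using that zs[of i] za[of i] unfolding spine_term_def by auto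
  qed
  have form: "edge_form ?V ?I caterpillar_parent x = z \<bullet> (M *\<^sub>v z) + D"
  proof -
    have "(\<Sum>i=1..k. ((if i = 1 then 0 else x (Spine i)) + (if i = k then 0 else x (Spine (Suc i))) + \<sigma> i)\<^sup>2)
      = (\<Sum>i=1..k. (spine_term k q (($) z) i)\<^sup>2)"
      by (intro sum.cong refl) (simp only: sp)
    then show ?thesis
      unfolding edge_form_caterpillar[OF k] \<sigma>_def[symmetric] pend2 M_form[OF z] lw by simp
  qed
  \<comment> \<open>The total deviation \<open>D\<close> enters the squared norm and the edge form
    with the same coefficient 1.\<close>
  have eq: "z \<bullet> (M *\<^sub>v z) = \<mu> * (z \<bullet> z) - (1 - \<mu>) * D"
    using x unfolding norm form by (simp add: algebra_simps)
  have D0: "D \<ge> 0" unfolding D_def d_def by (intro sum_nonneg) auto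
  have z0: "z \<bullet> z \<ge> 0" by (simp add: scalar_prod_def sum_nonneg)
  show ?thesis
  proof (cases "\<exists>i\<in>{1..k}. q i \<ge> 1")
    case False
    then have "D = 0" unfolding D_def d_def by (intro sum.neutral) (auto simp: not_le)
    then show ?thesis using that[OF z] xpos norm eq by simp
  next
    case True
    then obtain i where "i \<in> {1..k}" "q i \<ge> 1" by blast
    then obtain t where t: "t \<in> carrier_vec b" "t \<bullet> t > 0" "t \<bullet> (M *\<^sub>v t) = t \<bullet> t"
      by (rule unit_rayleigh_vector)
    have mu1: "\<mu> \<le> 1" using connectivity_le_form[OF t(1)] t by simp
    show ?thesis
    proof (cases "z \<bullet> z = 0")
      case True
      have "z = 0\<^sub>v b" using True scalar_prod_self_pos[OF z] by force
      then have "z \<bullet> (M *\<^sub>v z) = 0" using M_carrier by simp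
      then have "\<mu> = 1" using eq True xpos norm by simp
      then show ?thesis using that[OF t(1,2)] t(3) by simp
    next
      case False
      then have "z \<bullet> z > 0" using z0 by simp
      moreover have "z \<bullet> (M *\<^sub>v z) \<le> \<mu> * (z \<bullet> z)" unfolding eq using mu1 D0 by simp
      ultimately show ?thesis using that[OF z] by blast
    qed
  qed
qed

section \<open>The trace bounds\<close>

lemma C_deleted_shift:
  "2 \<cdot>\<^sub>m 1\<^sub>m (b - 1) + C_deleted k q i = mat_delete M (2 * i - 1) (2 * i - 1)"
  unfolding C_deleted_def M_def mat_delete_def by (intro eq_matI) (auto simp: C_matrix_def b)

lemma trace_bounds:
  shows "1 / mat_trace (inverse_mat M) \<le> \<mu>"
    and "i \<in> {1..k - 1} \<Longrightarrow>
      \<mu> \<le> 1 / (mat_trace (inverse_mat M) - mat_trace (inverse_mat (mat_delete M (2 * i - 1) (2 * i - 1))))"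
proof -
  obtain W where W: "W \<in> carrier_mat b b" and MW: "M * W = 1\<^sub>m b"
    using injective_mat_right_inverse[OF M_carrier M_inj] by blast
  have inv: "inverse_mat M = W" by (rule inverse_mat_eqI[OF M_carrier W MW])
  have bound: "x \<bullet> x \<le> (x \<bullet> (M *\<^sub>v x)) * mat_trace W" if "x \<in> carrier_vec b" for x
    by (rule sum_squares_le_form_times_trace_inverse[OF M_carrier M_sym M_psd W MW that])
  obtain t where t: "t \<in> carrier_vec b" "t \<bullet> t > 0" "t \<bullet> (M *\<^sub>v t) \<le> \<mu> * (t \<bullet> t)"
    by (rule connectivity_attained)
  \<comment> \<open>The trace must be positive, since \<open>bound\<close> at \<open>t\<close> has a
    positive left side and the form is nonnegative.\<close>
  have trpos: "mat_trace W > 0"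
    using bound[OF t(1)] t(2) M_psd[OF t(1)] by (smt (verit) mult_nonneg_nonpos)
  have "t \<bullet> t \<le> (\<mu> * (t \<bullet> t)) * mat_trace W"
    using bound[OF t(1)] mult_right_mono[OF t(3), of "mat_trace W"] trpos by linarith
  then have "(t \<bullet> t) * 1 \<le> (t \<bullet> t) * (\<mu> * mat_trace W)" by (simp add: mult_ac)
  then have "1 \<le> \<mu> * mat_trace W" using t(2) by (simp only: mult_le_cancel_left_pos)
  then show "1 / mat_trace (inverse_mat M) \<le> \<mu>" unfolding inv using trpos by (simp add: pos_divide_le_eq)
  assume i: "i \<in> {1..k - 1}"
  \<comment> \<open>Counted from 0, \<open>p\<close> is the coordinate of the spine edge joining
    vertices \<open>i\<close> and \<open>i + 1\<close>, and \<open>w\<close> solves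
    \<open>M w = e_p\<close>, so its form is just the entry of \<open>W\<close> at
    \<open>(p, p)\<close>.\<close>
  define p w where "p = 2 * i - 1" and "w = col W p"
  have p: "p < b" using i by (auto simp: b p_def)
  have w: "w \<in> carrier_vec b" using W by (auto simp: w_def intro: carrier_vecI)
  have Mw: "M *\<^sub>v w = unit_vec b p"
    using col_mult2[OF M_carrier W p] MW p by (simp add: w_def)
  have wMw: "w \<bullet> (M *\<^sub>v w) = W $$ (p, p)" using Mw w W p by (simp add: w_def)
  have "w \<noteq> 0\<^sub>v b"
  proof
    assume "w = 0\<^sub>v b"
    moreover have "M *\<^sub>v 0\<^sub>v b = 0\<^sub>v b" using M_carrier by (intro eq_vecI) auto
    ultimately have "unit_vec b p = (0\<^sub>v b :: real vec)" using Mw by simp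
    then show False using p by simp
  qed
  then have wpos: "w \<bullet> w > 0" using scalar_prod_self_pos[OF w] by simp
  have Wpp: "W $$ (p, p) > 0"
    using bound[OF w] wpos trpos unfolding wMw by (smt (verit) mult_nonpos_nonneg)
  have Suc_b: "b = Suc (b - 1)" using k b by simp
  have "mat_trace W - mat_trace (inverse_mat (mat_delete M p p)) = (w \<bullet> w) / W $$ (p, p)"
    unfolding w_def
    by (rule trace_inverse_mat_delete[of M "b - 1" W p, folded Suc_b])
      (use M_carrier M_sym W MW p Wpp in auto)
  moreover have "\<mu> \<le> W $$ (p, p) / (w \<bullet> w)"
    using connectivity_le_form[OF w] wpos unfolding wMw by (simp add: pos_le_divide_eq)
  ultimately show "\<mu> \<le> 1 / (mat_trace (inverse_mat M) - mat_trace (inverse_mat (mat_delete M (2 * i - 1) (2 * i - 1))))"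
    by (simp add: inv p_def)
qed

end

theorem theorem16:
  fixes k b :: nat and q :: "nat \<Rightarrow> nat" and \<mu> :: real
  assumes "k \<ge> 2"
    and "b = 2 * k - 1"
    and "\<mu> = algebraic_connectivity (caterpillar k q)"
  shows "1 / mat_trace (inverse_mat (2 \<cdot>\<^sub>m 1\<^sub>m b + C_matrix k q)) \<le> \<mu> \<and>
    \<mu> \<le> Min ((\<lambda>i. 1 / (mat_trace (inverse_mat (2 \<cdot>\<^sub>m 1\<^sub>m b + C_matrix k q))
                     - mat_trace (inverse_mat (2 \<cdot>\<^sub>m 1\<^sub>m (b - 1) + C_deleted k q i))))
              ` {1..k - 1})"
proof -
  interpret caterpillar_bounds k b q by standard (rule assms)+
  show ?thesis
    \<comment> \<open>The assumption \<open>k \<ge> 2\<close> makes the index set of the minimum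
      nonempty.\<close>
    using trace_bounds assms(1) unfolding assms(3) \<mu>_def C_deleted_shift M_def[symmetric]
    by (intro conjI Min.boundedI) auto
qed

end
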